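(* Let $\kappa,\lambda$ be infinite cardinals with $\kappa<\mathbf{c}$ and $\kappa\le\lambda\le 2^\kappa$. Then there exist $2^\lambda$ mutually non-homeomorphic connected and locally connected Hausdorff spaces of size $\kappa$ and weight $\lambda$. In particular, up to homeomorphism there exist precisely $2^{\mathbf{c}}$ countably infinite, connected, locally connected Hausdorff spaces and precisely $\mathbf{c}$ countably infinite, connected, locally connected, second countable Hausdorff spaces.
   Context: $\mathbf{c}=2^{\aleph_0}$. The size of a space is its cardinality; the weight is the least size of a basis. *)

theory Defs
  imports "HOL-Analysis.Analysis"
begin

unbundle cardinal_syntax

definition is_base :: "'a topology \<Rightarrow> 'a set set \<Rightarrow> bool"
  where "is_base X \<B> \<longleftrightarrow> openin X = arbitrary union_of (\<lambda>U. U \<in> \<B>)"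

(* As everywhere with ordLeq, the cardinal is only meaningful up to =o;
   the least size of a base exists by weight_least below. *)
definition weight :: "'a topology \<Rightarrow> 'a set rel"
  where "weight X = (SOME r. (\<exists>\<B>. is_base X \<B> \<and> r = |\<B>| ) \<and> (\<forall>\<B>. is_base X \<B> \<longrightarrow> r \<le>o |\<B>| ))"

lemma weight_least:
  shows weight_attained: "\<exists>\<B>. is_base X \<B> \<and> weight X = |\<B>|"
    and weight_le: "is_base X \<B> \<Longrightarrow> weight X \<le>o |\<B>|"
proof -
  have "is_base X {U. openin X U}"
    unfolding is_base_def by (auto simp: openin_topology_base_unique)
  then have "{|\<B>| |\<B>. is_base X \<B>} \<noteq> {}"
    by blast
  moreover have "\<forall>r \<in> {|\<B>| |\<B>. is_base X \<B>}. Card_order r"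
    using card_of_Card_order by blast
  ultimately have "\<exists>r \<in> {|\<B>| |\<B>. is_base X \<B>}. \<forall>r' \<in> {|\<B>| |\<B>. is_base X \<B>}. r \<le>o r'"
    by (rule exists_minim_Card_order)
  then have "\<exists>r. (\<exists>\<B>. is_base X \<B> \<and> r = |\<B>| ) \<and> (\<forall>\<B>. is_base X \<B> \<longrightarrow> r \<le>o |\<B>| )"
    by blast
  from someI_ex[OF this]
  show "\<exists>\<B>. is_base X \<B> \<and> weight X = |\<B>|" "is_base X \<B> \<Longrightarrow> weight X \<le>o |\<B>|"
    unfolding weight_def by blast+
qed

abbreviation continuum :: "(nat \<Rightarrow> bool) rel"
  where "continuum \<equiv> ctwo ^c natLeq"

definition clc_Hausdorff :: "'a topology \<Rightarrow> bool"
  where "clc_Hausdorff X \<longleftrightarrow>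
    connected_space X \<and> locally_connected_space X \<and> Hausdorff_space X"

definition mutually_nonhomeomorphic :: "'a topology set \<Rightarrow> bool"
  where "mutually_nonhomeomorphic \<F> \<longleftrightarrow> pairwise (\<lambda>X Y. \<not> X homeomorphic_space Y) \<F>"

end

theory Submission
  imports Defs "HOL-Number_Theory.Cong" "HOL-Computational_Algebra.Squarefree"
begin

text \<open>The spaces are built from the Kirch space \<open>K\<close> on the positive integers, whose basic open sets are
  the residue classes \<open>x + b\<nat>\<close> with \<open>b\<close> squarefree and coprime to \<open>x\<close>. Every basic set minus a finite
  set is connected, so \<open>K\<close> is connected, locally connected and has no cut points. Glue \<open>\<kappa>\<close> copies of \<open>K\<close>
  (the arms) at a common centre, with neighbourhoods of the centre governed by a free filter on the
  set of arms, and attach to the points of arm \<open>i\<close> finitely many further copies of \<open>K\<close> (the leaves), the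
  numbers of leaves encoding a set of naturals attached to \<open>i\<close>; since \<open>\<kappa> < c\<close>, these sets can be chosen
  distinct for distinct arms. Removing the centre leaves infinitely many components, namely the arms,
  while removing a point with \<open>n\<close> leaves produces \<open>n + 1\<close> of them. Hence a homeomorphism
  between two such spaces fixes the centre and maps every arm to itself, so that it transports one
  filter to the other. The weight is the character of the filter. An independent family of \<open>2\<^sup>\<kappa>\<close>
  subsets of \<open>\<kappa>\<close> provides, by choosing \<open>\<lambda>\<close> of its members as generators, \<open>2\<^sup>\<lambda>\<close> filters of character \<open>\<lambda>\<close>.\<close>

subsection \<open>Topologies given by neighbourhood bases\<close>

text \<open>The last axiom makes each member of \<open>nb z\<close> open, not just a neighbourhood
  of \<open>z\<close>, so that the families \<open>nb z\<close> jointly form a base.\<close>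

locale nbhd_system =
  fixes S :: "'a set" and nb :: "'a \<Rightarrow> 'a set set"
  assumes nb_nonempty: "z \<in> S \<Longrightarrow> nb z \<noteq> {}"
    and nb_subset: "z \<in> S \<Longrightarrow> N \<in> nb z \<Longrightarrow> N \<subseteq> S"
    and nb_refl: "z \<in> S \<Longrightarrow> N \<in> nb z \<Longrightarrow> z \<in> N"
    and nb_Int: "z \<in> S \<Longrightarrow> N \<in> nb z \<Longrightarrow> N' \<in> nb z \<Longrightarrow> \<exists>M\<in>nb z. M \<subseteq> N \<inter> N'"
    and nb_open: "z \<in> S \<Longrightarrow> N \<in> nb z \<Longrightarrow> w \<in> N \<Longrightarrow> \<exists>M\<in>nb w. M \<subseteq> N"
begin

definition nbhd_topology :: "'a topology"
  where "nbhd_topology = topology (\<lambda>U. U \<subseteq> S \<and> (\<forall>z\<in>U. \<exists>N\<in>nb z. N \<subseteq> U))"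

lemma openin_nbhd_topology:
  "openin nbhd_topology U \<longleftrightarrow> U \<subseteq> S \<and> (\<forall>z\<in>U. \<exists>N\<in>nb z. N \<subseteq> U)"
proof -
  have "istopology (\<lambda>U. U \<subseteq> S \<and> (\<forall>z\<in>U. \<exists>N\<in>nb z. N \<subseteq> U))"
    unfolding istopology_def
  proof (intro conjI allI impI)
    fix U V assume UV: "U \<subseteq> S \<and> (\<forall>z\<in>U. \<exists>N\<in>nb z. N \<subseteq> U)" "V \<subseteq> S \<and> (\<forall>z\<in>V. \<exists>N\<in>nb z. N \<subseteq> V)"
    show "U \<inter> V \<subseteq> S" using UV by blast
    show "\<forall>z\<in>U \<inter> V. \<exists>N\<in>nb z. N \<subseteq> U \<inter> V"
    proof
      fix z assume z: "z \<in> U \<inter> V"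
      then obtain N N' where N: "N \<in> nb z" "N \<subseteq> U" "N' \<in> nb z" "N' \<subseteq> V" using UV by blast
      have "z \<in> S" using z UV by blast
      from nb_Int[OF this N(1) N(3)] obtain M where "M \<in> nb z" "M \<subseteq> N \<inter> N'" by blast
      then show "\<exists>N\<in>nb z. N \<subseteq> U \<inter> V" using N by (meson Int_mono order_trans)
    qed
  next
    fix \<K> assume K: "\<forall>U\<in>\<K>. U \<subseteq> S \<and> (\<forall>z\<in>U. \<exists>N\<in>nb z. N \<subseteq> U)"
    then show "\<Union>\<K> \<subseteq> S" by blast
    show "\<forall>z\<in>\<Union>\<K>. \<exists>N\<in>nb z. N \<subseteq> \<Union>\<K>" using K by (meson UnionE Union_upper order_trans)
  qed
  then show ?thesis unfolding nbhd_topology_def by simp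
qed

lemma topspace_nbhd_topology [simp]: "topspace nbhd_topology = S"
proof -
  have "openin nbhd_topology S" 
    unfolding openin_nbhd_topology by (meson nb_nonempty nb_subset ex_in_conv order_refl)
  then show ?thesis
    by (metis openin_nbhd_topology openin_subset openin_topspace subset_antisym)
qed

lemma openin_nb: "z \<in> S \<Longrightarrow> N \<in> nb z \<Longrightarrow> openin nbhd_topology N"
  using nb_subset nb_open unfolding openin_nbhd_topology by blast

lemma is_base_nb: "is_base nbhd_topology (\<Union>z\<in>S. nb z)"
  unfolding is_base_def openin_topology_base_unique
  using openin_nb nb_refl by (simp add: openin_nbhd_topology) blast

end

subsection \<open>The Kirch space\<close>

definition kirch_class :: "nat \<Rightarrow> nat \<Rightarrow> nat set"
  where "kirch_class x b = {z. 0 < z \<and> [z = x] (mod b)}"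

text \<open>Squarefreeness distinguishes this topology from Golomb's, which admits all positive
  coprime moduli and is not locally connected.\<close>

definition kirch_nb :: "nat \<Rightarrow> nat set set"
  where "kirch_nb x = {kirch_class x b |b. squarefree b \<and> coprime x b}"

lemma ex_kirch_nbI:
  "squarefree b \<Longrightarrow> coprime x b \<Longrightarrow> kirch_class x b \<subseteq> U \<Longrightarrow> \<exists>N\<in>kirch_nb x. N \<subseteq> U"
  unfolding kirch_nb_def by blast

lemma mem_kirch_class: "z \<in> kirch_class x b \<longleftrightarrow> 0 < z \<and> [z = x] (mod b)"
  by (simp add: kirch_class_def)

section \<open>Arithmetic of squarefree moduli\<close>

lemma squarefree_pos: "squarefree (b::nat) \<Longrightarrow> 0 < b"
  by (metis gr0I not_squarefree_0)

text \<open>A common divisor of the cofactor \<open>e'\<close> and \<open>b\<close> divides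
  \<open>gcd e b\<close> as well, so its square divides \<open>e\<close>.\<close>

lemma squarefree_split:
  fixes e b :: nat
  assumes "squarefree e"
  obtains e' where "e = gcd e b * e'" "coprime e' b" "coprime e' (gcd e b)"
proof -
  have e0: "e \<noteq> 0" using assms by (metis not_squarefree_0)
  obtain e' where e': "e = gcd e b * e'" by (metis dvdE gcd_dvd1)
  have *: "coprime e' b"
  proof (rule coprimeI)
    fix p assume p: "p dvd e'" "p dvd b"
    then have "p dvd gcd e b" using e' by (metis dvd_mult gcd_greatest)
    then have "p * p dvd e" using p e' by (metis mult_dvd_mono)
    then show "is_unit p" using assms unfolding squarefree_def power2_eq_square by blast
  qed
  show ?thesis
    using that[OF e' *] * by (meson coprime_divisors dvd_refl gcd_dvd2)
qed

text \<open>Only the part of \<open>b\<close> prime to \<open>a\<close> is new in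
  \<open>lcm a b\<close>, which therefore divides a product of two coprime squarefree
  numbers.\<close>

lemma squarefree_lcm:
  fixes a b :: nat
  assumes "squarefree a" "squarefree b"
  shows "squarefree (lcm a b)"
proof -
  obtain e where e: "b = gcd b a * e" "coprime e a"
    using squarefree_split[OF assms(2)] by blast
  have "squarefree e" using assms(2) e(1) by (metis dvd_triv_right squarefree_mono)
  then have *: "squarefree (a * e)"
    using assms(1) e(2) by (simp add: squarefree_mult_coprime coprime_commute)
  have "b dvd a * e" using e(1) by (metis gcd_dvd2 mult_dvd_mono dvd_refl)
  then have "lcm a b dvd a * e" by simp
  then show ?thesis using * squarefree_mono by blast
qed

lemma coprime_lcm_right: "coprime a (lcm b c) \<longleftrightarrow> coprime a b \<and> coprime (a::nat) c"
  by (smt (verit, best) coprime_commute coprime_divisors coprime_mult_right_iff dvd_lcm1 dvd_lcm2 dvd_refl lcm_least dvd_triv_left dvd_triv_right)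

lemma cong_avoiding_finite:
  fixes a m :: nat
  assumes "0 < m" "finite E"
  obtains z where "0 < z" "z \<notin> E" "[z = a] (mod m)"
proof -
  \<comment> \<open>Inserting 0 keeps the argument of \<open>Max\<close> nonempty when
    \<open>E = {}\<close>.\<close>
  define z where "z = a + m * Suc (Max (insert 0 E))"
  have "Max (insert 0 E) < z" 
  proof -
    have "1 * Suc (Max (insert 0 E)) \<le> m * Suc (Max (insert 0 E))"
      using assms(1) by (intro mult_le_mono1) simp
    then show ?thesis unfolding z_def by (metis Suc_le_lessD mult_1 trans_less_add2)
  qed
  then have "0 < z" "z \<notin> E" using assms(2)
    by (auto dest: Max_ge[of "insert 0 E", rotated])
  moreover have "[z = a] (mod m)" unfolding z_def by (metis cong_def mod_mult_self2)
  ultimately show ?thesis using that by blast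
qed

interpretation kirch: nbhd_system "{0<..}" kirch_nb
proof
  fix z :: nat and N N' w
  assume z: "z \<in> {0<..}"
  show "kirch_nb z \<noteq> {}"
    unfolding kirch_nb_def by (auto intro!: exI[of _ 1])
  show "N \<subseteq> {0<..}" "z \<in> N" if "N \<in> kirch_nb z"
    using that z unfolding kirch_nb_def by (auto simp: mem_kirch_class)
  show "\<exists>M\<in>kirch_nb z. M \<subseteq> N \<inter> N'" if N: "N \<in> kirch_nb z" "N' \<in> kirch_nb z"
  proof -
    obtain b b' where b: "N = kirch_class z b" "squarefree b" "coprime z b"
      "N' = kirch_class z b'" "squarefree b'" "coprime z b'"
      using N unfolding kirch_nb_def by blast
    have "kirch_class z (lcm b b') \<subseteq> N \<inter> N'"
      unfolding b using cong_dvd_modulus_nat by (auto simp: mem_kirch_class)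
    moreover have "kirch_class z (lcm b b') \<in> kirch_nb z"
      unfolding kirch_nb_def using b squarefree_lcm coprime_lcm_right by blast
    ultimately show ?thesis by blast
  qed
  show "\<exists>M\<in>kirch_nb w. M \<subseteq> N" if N: "N \<in> kirch_nb z" "w \<in> N"
  proof -
    obtain b where b: "N = kirch_class z b" "squarefree b" "coprime z b"
      using N unfolding kirch_nb_def by blast
    \<comment> \<open>Every point of a residue class serves as its centre, and congruence modulo
      \<open>b\<close> transfers coprimality to \<open>b\<close>.\<close>
    have wz: "[w = z] (mod b)" using N b by (auto simp: mem_kirch_class)
    then have "coprime w b" using b(3) by (metis cong_imp_coprime cong_sym)
    moreover have "kirch_class w b = N" unfolding b kirch_class_def
      using wz by (auto intro: cong_trans cong_sym)
    ultimately show ?thesis unfolding kirch_nb_def using b(2) by blast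
  qed
qed

abbreviation kirch :: "nat topology" where "kirch \<equiv> kirch.nbhd_topology"

lemma kirch_nbhd:
  assumes "openin kirch U" "x \<in> U"
  obtains b where "squarefree b" "coprime x b" "kirch_class x b \<subseteq> U"
  using assms unfolding kirch.openin_nbhd_topology kirch_nb_def by blast

text \<open>Choosing \<open>c\<close> divisible by the part \<open>d\<close> of the moduli prime to \<open>b\<close> forces every modulus \<open>e\<close> admissible
  at \<open>c\<close> to be coprime to \<open>d\<close>, so the two congruences can conflict only modulo a divisor of \<open>b\<close>, where
  both residues are \<open>a\<close>.\<close>

lemma kirch_classes_meet:
  assumes b2: "squarefree b2" and e: "squarefree e" and b: "squarefree b"
    and va: "[v = a] (mod b)" and ca: "[c = a] (mod b)" and ce: "coprime c e"
    and d: "coprime d b" "d dvd c" "b2 dvd b * d" and E: "finite E"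
  shows "\<exists>z. z \<in> kirch_class c e \<and> z \<in> kirch_class v b2 \<and> z \<in> kirch_class a b - E"
proof -
  obtain e' where e': "e = gcd e b * e'" "coprime e' b" "coprime e' (gcd e b)"
    using squarefree_split[OF e] by blast
  have "coprime e d" using ce d(2) by (meson coprime_commute coprime_divisors dvd_refl)
  then have "coprime e' d" using e'(1) by (metis coprime_mult_left_iff)
  then have "coprime e' (b * d)" using e'(2) by simp
  then have *: "coprime e' b2" using d(3) by (meson coprime_divisors dvd_refl)
  have co: "coprime e' (lcm b b2)" using * e'(2) by (simp add: coprime_lcm_right)
  obtain z0 where z0: "[z0 = c] (mod e')" "[z0 = v] (mod (lcm b b2))"
    using binary_chinese_remainder_nat[OF co] by blast
  have "0 < e' * lcm b b2" using squarefree_pos[OF e] squarefree_pos[OF b] squarefree_pos[OF b2] e'(1)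
    by (metis lcm_eq_0_iff mult_is_0 neq0_conv)
  then obtain z where z: "0 < z" "z \<notin> E" "[z = z0] (mod (e' * lcm b b2))"
    using cong_avoiding_finite[OF _ E] by blast
  have z1: "[z = c] (mod e')" using z(3) z0(1)
    by (meson cong_dvd_modulus_nat cong_trans dvd_triv_left)
  have z2: "[z = v] (mod (lcm b b2))" using z(3) z0(2)
    by (meson cong_dvd_modulus_nat cong_trans dvd_triv_right)
  have zb: "[z = v] (mod b)" using z2 cong_dvd_modulus_nat by (meson dvd_lcm1)
  have zb2: "[z = v] (mod b2)" using z2 cong_dvd_modulus_nat by (meson dvd_lcm2)
  have za: "[z = a] (mod b)" using zb va by (rule cong_trans)
  \<comment> \<open>The factor \<open>gcd e b\<close> of \<open>e\<close> was not prescribed for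
    \<open>c\<close>: modulo \<open>b\<close>, hence modulo this divisor, \<open>z\<close> and
    \<open>c\<close> both have the residue \<open>a\<close>.\<close>
  have "[z = c] (mod b)" using za ca by (metis cong_sym cong_trans)
  then have "[z = c] (mod (gcd e b))" by (meson cong_dvd_modulus_nat gcd_dvd2)
  with z1 have "[z = c] (mod (gcd e b * e'))"
    using e'(3) by (metis coprime_cong_mult_nat coprime_commute)
  then have "[z = c] (mod e)" using e'(1) by simp
  then show ?thesis using z za zb2 by (auto simp: mem_kirch_class)
qed

text \<open>Given a separation, take classes around \<open>u\<close> and \<open>v\<close> and a
  point \<open>c\<close> of the set divisible by the part of their moduli prime to \<open>b\<close>.
  On whichever side \<open>c\<close> lies, its neighbourhoods meet the class chosen on the other
  side. The finite set \<open>E\<close> does no harm, as solutions of congruences can be shifted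
  past it.\<close>

lemma connectedin_kirch:
  assumes a: "0 < a" and b: "squarefree b" and ab: "coprime a b" and E: "finite E"
  shows "connectedin kirch (kirch_class a b - E)" (is "connectedin _ ?W")
  unfolding connectedin
proof (intro conjI notI)
  show "?W \<subseteq> topspace kirch" by (auto simp: mem_kirch_class)
  assume "\<exists>U V. openin kirch U \<and> openin kirch V \<and> ?W \<subseteq> U \<union> V \<and> U \<inter> V \<inter> ?W = {} \<and> U \<inter> ?W \<noteq> {} \<and> V \<inter> ?W \<noteq> {}"
  then obtain U V u v where UV: "openin kirch U" "openin kirch V" "?W \<subseteq> U \<union> V" "U \<inter> V \<inter> ?W = {}"
    and u: "u \<in> U" "u \<in> ?W" and v: "v \<in> V" "v \<in> ?W" by blast
  obtain b1 where b1: "squarefree b1" "kirch_class u b1 \<subseteq> U" using kirch_nbhd[OF UV(1) u(1)] by blast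
  obtain b2 where b2: "squarefree b2" "kirch_class v b2 \<subseteq> V" using kirch_nbhd[OF UV(2) v(1)] by blast
  \<comment> \<open>Both moduli enter \<open>d\<close>, so the same \<open>c\<close> works whether
    it falls into \<open>U\<close> or into \<open>V\<close>.\<close>
  obtain d where d: "lcm b1 b2 = gcd (lcm b1 b2) b * d" "coprime d b"
    using squarefree_split[OF squarefree_lcm[OF b1(1) b2(1)]] by blast
  have dpos: "0 < d" using d(1) squarefree_pos[OF b1(1)] squarefree_pos[OF b2(1)]
    by (metis lcm_eq_0_iff mult_is_0 neq0_conv)
  have ldvd: "lcm b1 b2 dvd b * d" using d(1) by (metis gcd_dvd2 mult_dvd_mono dvd_refl)
  have dv: "b1 dvd b * d" "b2 dvd b * d" using ldvd by (meson dvd_lcm1 dvd_lcm2 dvd_trans)+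
  obtain c0 where c0: "[c0 = a] (mod b)" "[c0 = 0] (mod d)"
    using binary_chinese_remainder_nat[of b d] d(2) by (metis coprime_commute)
  obtain c where c: "0 < c" "c \<notin> E" "[c = c0] (mod (b * d))"
    using cong_avoiding_finite[OF _ E, of "b * d"] dpos squarefree_pos[OF b] by (metis nat_0_less_mult_iff)
  have ca: "[c = a] (mod b)" using c(3) c0(1) by (meson cong_dvd_modulus_nat cong_trans dvd_triv_left)
  have "[c = 0] (mod d)" using c(3) c0(2) by (meson cong_dvd_modulus_nat cong_trans dvd_triv_right)
  then have dc: "d dvd c" by (simp add: cong_0_iff)
  have cW: "c \<in> ?W" using c ca by (simp add: mem_kirch_class)
  have uva: "[u = a] (mod b)" "[v = a] (mod b)" using u v by (simp_all add: mem_kirch_class)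
  show False
  proof (cases "c \<in> U")
    case True
    obtain e where e: "squarefree e" "coprime c e" "kirch_class c e \<subseteq> U" using kirch_nbhd[OF UV(1) True] by blast
    show False
      using kirch_classes_meet[OF b2(1) e(1) b uva(2) ca e(2) d(2) dc dv(2) E] UV(4) e(3) b2(2) by blast
  next
    case False
    then have "c \<in> V" using UV(3) cW by blast
    then obtain e where e: "squarefree e" "coprime c e" "kirch_class c e \<subseteq> V" using kirch_nbhd[OF UV(2)] by blast
    show False
      using kirch_classes_meet[OF b1(1) e(1) b uva(1) ca e(2) d(2) dc dv(1) E] UV(4) e(3) b1(2) by blast
  qed
qed

lemma kirch_class_1: "kirch_class x 1 = {0<..}"
  by (auto simp: mem_kirch_class)

lemma connectedin_kirch_cofinite: "finite E \<Longrightarrow> connectedin kirch ({0<..} - E)"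
  using connectedin_kirch[of 1 1 E] by (simp add: kirch_class_1[simplified])

subsection \<open>Hedgehogs of Kirch spaces\<close>

text \<open>In a copy of \<open>K\<close> the point \<open>1\<close> is the one that is glued: \<open>Spoke i x\<close> and \<open>Leaf i x j y\<close> occur only
  for \<open>x, y \<ge> 2\<close>. The point \<open>1\<close> of arm \<open>i\<close> is \<open>Center\<close>, and the point \<open>1\<close> of leaf \<open>j\<close> at \<open>Spoke i x\<close> is
  \<open>Spoke i x\<close>.\<close>

datatype 'i pt = Center | Spoke 'i nat | Leaf 'i nat nat nat

text \<open>The coordinate to which the modulus of a neighbourhood must be coprime. In the copies
  attached to a point it has coordinate 1, which admits every modulus.\<close>

fun label :: "'i pt \<Rightarrow> nat"
  where
    "label Center = 1"
  | "label (Spoke i x) = x"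
  | "label (Leaf i x j y) = y"

text \<open>\<open>m i x\<close> counts the leaves attached at \<open>Spoke i x\<close>, and
  \<open>\<Phi>\<close> is a base of the filter at the centre. Freeness provides neighbourhoods of
  the centre that do not fill a given arm.\<close>

locale hedgehog =
  fixes I :: "'i set" and m :: "'i \<Rightarrow> nat \<Rightarrow> nat" and \<Phi> :: "'i set set"
  assumes \<Phi>_nonempty: "\<Phi> \<noteq> {}"
    and \<Phi>_directed: "A \<in> \<Phi> \<Longrightarrow> A' \<in> \<Phi> \<Longrightarrow> \<exists>B\<in>\<Phi>. B \<subseteq> A \<inter> A'"
    and \<Phi>_free: "i \<in> I \<Longrightarrow> \<exists>A\<in>\<Phi>. i \<notin> A"
begin

fun valid :: "'i pt \<Rightarrow> bool"
  where
    "valid Center \<longleftrightarrow> True"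
  | "valid (Spoke i x) \<longleftrightarrow> i \<in> I \<and> 2 \<le> x"
  | "valid (Leaf i x j y) \<longleftrightarrow> i \<in> I \<and> 2 \<le> x \<and> j < m i x \<and> 2 \<le> y"

definition points :: "'i pt set"
  where "points = {z. valid z}"

lemma mem_points [simp]: "z \<in> points \<longleftrightarrow> valid z"
  by (simp add: points_def)

text \<open>Neighbourhoods of the centre contain the arms in \<open>A\<close> entirely. Neighbourhoods of a spoke point carry
  the full leaves at the other spoke points they contain, which is why proving them open requires
  enlarging the modulus to exclude \<open>x\<close>.\<close>

fun near :: "'i pt \<Rightarrow> 'i set \<Rightarrow> nat \<Rightarrow> 'i pt \<Rightarrow> bool"
  where
    "near Center A b Center \<longleftrightarrow> True"
  | "near Center A b (Spoke i x) \<longleftrightarrow> i \<in> I \<and> 2 \<le> x \<and> (i \<in> A \<or> [x = 1] (mod b))"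
  | "near Center A b (Leaf i x j y) \<longleftrightarrow>
      i \<in> I \<and> 2 \<le> x \<and> (i \<in> A \<or> [x = 1] (mod b)) \<and> j < m i x \<and> 2 \<le> y"
  | "near (Spoke i x) A b Center \<longleftrightarrow> False"
  | "near (Spoke i x) A b (Spoke i' x') \<longleftrightarrow> i' = i \<and> 2 \<le> x' \<and> [x' = x] (mod b)"
  | "near (Spoke i x) A b (Leaf i' x' j y) \<longleftrightarrow>
      i' = i \<and> 2 \<le> x' \<and> [x' = x] (mod b) \<and> j < m i x' \<and> 2 \<le> y \<and> (x' = x \<longrightarrow> [y = 1] (mod b))"
  | "near (Leaf i x j y) A b Center \<longleftrightarrow> False"
  | "near (Leaf i x j y) A b (Spoke i' x') \<longleftrightarrow> False"
  | "near (Leaf i x j y) A b (Leaf i' x' j' y') \<longleftrightarrow>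
      i' = i \<and> x' = x \<and> j' = j \<and> 2 \<le> y' \<and> [y' = y] (mod b)"

definition nb :: "'i pt \<Rightarrow> 'i pt set set"
  where "nb z = {Collect (near z A b) |A b. A \<in> \<Phi> \<and> squarefree b \<and> coprime (label z) b}"

lemma nbI: "A \<in> \<Phi> \<Longrightarrow> squarefree b \<Longrightarrow> coprime (label z) b \<Longrightarrow> Collect (near z A b) \<in> nb z"
  unfolding nb_def by blast

lemma nbE:
  assumes "N \<in> nb z"
  obtains A b where "A \<in> \<Phi>" "squarefree b" "coprime (label z) b" "N = Collect (near z A b)"
  using assms unfolding nb_def by blast

lemma near_mono:
  assumes "near z A' b' w" "A' \<subseteq> A" "b dvd b'"
  shows "near z A b w"
  using assms cong_dvd_modulus_nat[of _ _ b' b]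
  by (cases z; cases w) auto

lemma near_valid: "valid z \<Longrightarrow> near z A b w \<Longrightarrow> valid w"
  by (cases z; cases w) auto

lemma near_refl: "valid z \<Longrightarrow> near z A b z"
  by (cases z) auto

text \<open>A prime beyond \<open>n\<close> works. As a factor of a modulus it expels finitely many
  unwanted coordinates from a neighbourhood.\<close>

lemma ex_separating_modulus:
  obtains p :: nat where "squarefree p" "\<And>x. 0 < x \<Longrightarrow> x \<le> n \<Longrightarrow> coprime x p"
    "\<And>x y. x \<le> n \<Longrightarrow> y \<le> n \<Longrightarrow> [x = y] (mod p) \<Longrightarrow> x = y"
proof -
  obtain p where p: "prime p" "n < p" using bigger_prime by blast
  have "coprime x p" if "0 < x" "x \<le> n" for x
    using p that by (metis coprime_commute nat_dvd_not_less order_le_less_trans prime_imp_coprime)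
  moreover have "x = y" if "x \<le> n" "y \<le> n" "[x = y] (mod p)" for x y
    using p that by (simp add: cong_def)
  moreover have "squarefree p" using p(1) by (simp add: squarefree_prime)
  ultimately show ?thesis using that by blast
qed

lemma near_open:
  assumes z: "valid z" and A: "A \<in> \<Phi>" and b: "squarefree b" "coprime (label z) b" and w: "near z A b w"
  shows "\<exists>b'. squarefree b' \<and> coprime (label w) b' \<and> (\<forall>v. near w A b' v \<longrightarrow> near z A b v)"
proof -
  have co: "coprime x b" if "[x = y] (mod b)" "coprime y b" for x y
    using that by (metis cong_imp_coprime cong_sym)
  \<comment> \<open>The cases follow the way from \<open>z\<close> to \<open>w\<close>: along the
    arm, from a foot into its leaf, within a leaf, or, in \<open>full\<close>, onto a leaf contained
    entirely, where modulus 1 suffices.\<close>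
  consider (eq) "w = z"
    | (cs) i x where "z = Center" "w = Spoke i x" "i \<in> A \<or> [x = 1] (mod b)"
    | (ss) i x x' where "z = Spoke i x" "w = Spoke i x'" "x' \<noteq> x" "[x' = x] (mod b)"
    | (sl) i x j y where "z = Spoke i x" "w = Leaf i x j y" "[y = 1] (mod b)"
    | (ll) i x j y y' where "z = Leaf i x j y" "w = Leaf i x j y'" "[y' = y] (mod b)"
    | (full) i x j y where "w = Leaf i x j y" "z = Center \<or> (\<exists>x'. z = Spoke i x' \<and> x' \<noteq> x)"
    using w by (cases z; cases w) auto
  then show ?thesis
  proof cases
    case eq
    then show ?thesis using b by blast
  next
    case cs
    show ?thesis
    proof (cases "i \<in> A")
      case True
      have "near z A b v" if "near w A 1 v" for v
        using that w True unfolding cs by (cases v) auto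
      then show ?thesis by (intro exI[of _ 1]) auto
    next
      case False
      then have x: "[x = 1] (mod b)" using cs by blast
      then have "coprime x b" using co by simp
      moreover have "near z A b v" if "near w A b v" for v
        using that w x cong_trans[OF _ x] unfolding cs by (cases v) auto
      ultimately show ?thesis using b cs by auto
    qed
  next
    case ss
    \<comment> \<open>The bound covers \<open>b\<close>, making \<open>b * p\<close> squarefree,
      \<open>x'\<close>, making it admissible, and the pair \<open>x\<close>, \<open>x'\<close> to
      be told apart.\<close>
    obtain p where p: "squarefree p" "\<And>k. 0 < k \<Longrightarrow> k \<le> b + x + x' \<Longrightarrow> coprime k p"
      "\<And>k l. k \<le> b + x + x' \<Longrightarrow> l \<le> b + x + x' \<Longrightarrow> [k = l] (mod p) \<Longrightarrow> k = l"
      using ex_separating_modulus by blast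
    have "squarefree (b * p)"
      using b p squarefree_pos[OF b(1)] by (simp add: squarefree_mult_coprime)
    moreover have "coprime x' (b * p)"
      using co[OF ss(4)] b ss w p by auto
    moreover have "near z A b v" if v: "near w A (b * p) v" for v
    proof -
      have *: "[k = x] (mod b)" "k \<noteq> x" if "[k = x'] (mod (b * p))" for k
      proof -
        show "[k = x] (mod b)" using that ss(4)
          by (meson cong_dvd_modulus_nat cong_trans dvd_triv_left)
        have "[k = x'] (mod p)" using that by (meson cong_dvd_modulus_nat dvd_triv_right)
        then show "k \<noteq> x" using p(3)[of x x'] ss(3) by auto
      qed
      show ?thesis using v w * unfolding ss by (cases v) auto
    qed
    ultimately show ?thesis using ss by auto
  next
    case sl
    have "coprime y b" using co[OF sl(3)] by simp
    moreover have "near z A b v" if "near w A b v" for v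
      using that w cong_trans[OF _ sl(3)] unfolding sl by (cases v) auto
    ultimately show ?thesis using b sl by auto
  next
    case ll
    have "coprime y' b" using co[OF ll(3)] b ll by simp
    moreover have "near z A b v" if "near w A b v" for v
      using that w cong_trans[OF _ ll(3)] unfolding ll by (cases v) auto
    ultimately show ?thesis using b ll by auto
  next
    case full
    have "near z A b v" if "near w A 1 v" for v
      using that w full by (cases v) auto
    then show ?thesis by (intro exI[of _ 1]) auto
  qed
qed

sublocale nbhd_system points nb
proof
  fix z N N' w
  assume "z \<in> points"
  then have z: "valid z" by simp
  show "nb z \<noteq> {}"
  proof -
    obtain A where "A \<in> \<Phi>" using \<Phi>_nonempty by blast
    then show ?thesis using nbI[of A 1 z] by auto
  qed
  show "N \<subseteq> points" "z \<in> N" if "N \<in> nb z"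
    using that z near_valid near_refl by (auto elim!: nbE)
  show "\<exists>M\<in>nb z. M \<subseteq> N \<inter> N'" if N: "N \<in> nb z" "N' \<in> nb z"
  proof -
    obtain A b A' b' where A: "A \<in> \<Phi>" "squarefree b" "coprime (label z) b" "N = Collect (near z A b)"
      "A' \<in> \<Phi>" "squarefree b'" "coprime (label z) b'" "N' = Collect (near z A' b')"
      using N by (elim nbE)
    obtain B where B: "B \<in> \<Phi>" "B \<subseteq> A \<inter> A'" using \<Phi>_directed A by blast
    have "Collect (near z B (lcm b b')) \<subseteq> N \<inter> N'"
      unfolding A using B by (auto elim!: near_mono)
    moreover have "Collect (near z B (lcm b b')) \<in> nb z"
      using A B squarefree_lcm coprime_lcm_right by (intro nbI) auto
    ultimately show ?thesis by blast
  qed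
  show "\<exists>M\<in>nb w. M \<subseteq> N" if N: "N \<in> nb z" "w \<in> N"
  proof -
    obtain A b where A: "A \<in> \<Phi>" "squarefree b" "coprime (label z) b" "N = Collect (near z A b)"
      using N by (elim nbE)
    obtain b' where "squarefree b'" "coprime (label w) b'" "\<forall>v. near w A b' v \<longrightarrow> near z A b v"
      using near_open[OF z A(1-3)] N(2) A(4) by auto
    then show ?thesis using nbI[of A b' w] A by blast
  qed
qed

abbreviation X :: "'i pt topology" where "X \<equiv> nbhd_topology"

lemma openin_near:
  "valid z \<Longrightarrow> A \<in> \<Phi> \<Longrightarrow> squarefree b \<Longrightarrow> coprime (label z) b \<Longrightarrow> openin X (Collect (near z A b))"
  using openin_nb nbI by simp

lemma openin_X_iff:
  "openin X U \<longleftrightarrow> U \<subseteq> points \<and>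
    (\<forall>z\<in>U. \<exists>A\<in>\<Phi>. \<exists>b. squarefree b \<and> coprime (label z) b \<and> Collect (near z A b) \<subseteq> U)"
  unfolding openin_nbhd_topology nb_def by blast

section \<open>Separation of points\<close>

lemma label_pos: "valid z \<Longrightarrow> 0 < label z"
  by (cases z) auto

text \<open>Set-valued so that the centre, which lies on no arm, needs no separate treatment when a
  filter set has to avoid the arms of given points.\<close>

fun arm_of :: "'i pt \<Rightarrow> 'i set"
  where "arm_of Center = {}" | "arm_of (Spoke i x) = {i}" | "arm_of (Leaf i x j y) = {i}"

text \<open>The coordinate on the arm, of the point itself or of the foot of its leaf.\<close>

fun height :: "'i pt \<Rightarrow> nat"
  where "height Center = 1" | "height (Spoke i x) = x" | "height (Leaf i x j y) = x"

lemma ex_avoiding: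
  assumes "valid z"
  shows "\<exists>A\<in>\<Phi>. arm_of z \<inter> A = {}"
  using assms \<Phi>_free \<Phi>_nonempty by (cases z) auto

text \<open>Both neighbourhoods use one modulus separating all coordinates involved, including the
  gluing coordinate 1, and one filter set avoiding both arms. Where their shapes do not already make
  them disjoint, a common point would have a coordinate congruent to two different small
  numbers.\<close>

lemma Hausdorff_X: "Hausdorff_space X"
  unfolding Hausdorff_space_def
proof (intro allI impI)
  fix z w assume "z \<in> topspace X \<and> w \<in> topspace X \<and> z \<noteq> w"
  then have zw: "valid z" "valid w" "z \<noteq> w" by auto
  define n where "n = 1 + height z + height w + label z + label w"
  obtain p where p: "squarefree p" "\<And>k. 0 < k \<Longrightarrow> k \<le> n \<Longrightarrow> coprime k p"
    "\<And>k l. k \<le> n \<Longrightarrow> l \<le> n \<Longrightarrow> [k = l] (mod p) \<Longrightarrow> k = l"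
    using ex_separating_modulus by blast
  obtain A1 A2 where A12: "A1 \<in> \<Phi>" "arm_of z \<inter> A1 = {}" "A2 \<in> \<Phi>" "arm_of w \<inter> A2 = {}"
    using ex_avoiding zw by meson
  obtain A where A: "A \<in> \<Phi>" "A \<subseteq> A1 \<inter> A2" using \<Phi>_directed A12 by blast
  have Az: "arm_of z \<inter> A = {}" "arm_of w \<inter> A = {}" using A A12 by blast+
  have sep: "k = l" if "k \<le> n" "l \<le> n" "[v = k] (mod p)" "[v = l] (mod p)" for k l v
    using p(3) that by (metis cong_sym cong_trans)
  have le: "1 \<le> n" "height z \<le> n" "height w \<le> n" "label z \<le> n" "label w \<le> n"
    unfolding n_def by auto
  have s: "height z = 1" if "[v = height z] (mod p)" "[v = 1] (mod p)" for v
    using sep[of "height z" 1 v] le that by simp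
  have s': "height w = 1" if "[v = height w] (mod p)" "[v = 1] (mod p)" for v
    using sep[of "height w" 1 v] le that by simp
  have l: "label z = 1" if "[v = label z] (mod p)" "[v = 1] (mod p)" for v
    using sep[of "label z" 1 v] le that by simp
  have l': "label w = 1" if "[v = label w] (mod p)" "[v = 1] (mod p)" for v
    using sep[of "label w" 1 v] le that by simp
  have h: "height z = height w" if "[v = height z] (mod p)" "[v = height w] (mod p)" for v
    using sep[of "height z" "height w" v] le that by simp
  have k: "label z = label w" if "[v = label z] (mod p)" "[v = label w] (mod p)" for v
    using sep[of "label z" "label w" v] le that by simp
  have disj: "\<not> (near z A p v \<and> near w A p v)" for v
  proof (cases z)
    case Center
    then show ?thesis using zw Az s' s'[of "height w", OF cong_refl]
      by (cases w; cases v) auto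
  next
    case (Spoke i x)
    then show ?thesis using zw Az s h l'
      by (cases w; cases v) (auto, metis cong_refl)
  next
    case (Leaf i x j y)
    then show ?thesis using zw Az s[of "height z", OF cong_refl] h[of "height z", OF cong_refl] l k
      by (cases w; cases v) auto
  qed
  show "\<exists>U V. openin X U \<and> openin X V \<and> z \<in> U \<and> w \<in> V \<and> disjnt U V"
  proof (intro exI conjI)
    show "openin X (Collect (near z A p))" "openin X (Collect (near w A p))"
      using zw A p le label_pos by (auto intro!: openin_near)
  qed (use zw near_refl disj in \<open>auto simp: disjnt_iff\<close>)
qed

end

subsection \<open>Cut points\<close>

lemma connectedin_attach:
  assumes C: "connectedin X C" and D: "\<And>D. D \<in> \<D> \<Longrightarrow> connectedin X D \<and> C \<inter> D \<noteq> {}"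
  shows "connectedin X (C \<union> \<Union>\<D>)"
proof (cases "C = {}")
  case True
  then have "\<D> = {}" using D by blast
  then show ?thesis using True by simp
next
  case False
  have "connectedin X (\<Union>(insert C ((\<lambda>D. C \<union> D) ` \<D>)))"
    using C D False by (intro connectedin_Union) (auto intro: connectedin_Un)
  moreover have "\<Union>(insert C ((\<lambda>D. C \<union> D) ` \<D>)) = C \<union> \<Union>\<D>" by blast
  ultimately show ?thesis by simp
qed

text \<open>The pieces other than \<open>C\<close> form an open set, so a connected set meeting
  \<open>C\<close> cannot leave it.\<close>

lemma connected_components_of_open_partition:
  assumes "pairwise disjnt \<C>" "\<Union>\<C> = topspace X"
    and C: "\<And>C. C \<in> \<C> \<Longrightarrow> openin X C \<and> connectedin X C \<and> C \<noteq> {}"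
  shows "connected_components_of X = \<C>"
proof -
  have *: "connected_component_of_set X x = C" if "C \<in> \<C>" "x \<in> C" for C x
  proof (rule connected_component_of_unique)
    show "x \<in> C" "connectedin X C" using that C by blast+
    fix C' assume C': "x \<in> C' \<and> connectedin X C'"
    have "openin X (\<Union>(\<C> - {C}))" using C by blast
    moreover have "C' \<subseteq> C \<union> \<Union>(\<C> - {C})"
      using C' connectedin_subset_topspace[of X C'] assms(2) by blast
    moreover have "C \<inter> \<Union>(\<C> - {C}) = {}"
      using assms(1) that(1) unfolding pairwise_def disjnt_def by blast
    ultimately have "C' \<inter> \<Union>(\<C> - {C}) = {}"
      using connectedinD[of X C' C "\<Union>(\<C> - {C})"] C C' that by blast
    then show "C' \<subseteq> C" using \<open>C' \<subseteq> C \<union> \<Union>(\<C> - {C})\<close> by blast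
  qed
  show ?thesis
    unfolding connected_components_of_def
  proof (intro equalityI subsetI)
    fix D assume "D \<in> connected_component_of_set X ` topspace X"
    then obtain x where x: "x \<in> topspace X" "D = connected_component_of_set X x" by blast
    then obtain C where "C \<in> \<C>" "x \<in> C" using assms(2) by blast
    then show "D \<in> \<C>" using * x by simp
  next
    fix D assume D: "D \<in> \<C>"
    then obtain x where "x \<in> D" using C by blast
    then have "x \<in> topspace X" "D = connected_component_of_set X x"
      using * D assms(2) by auto
    then show "D \<in> connected_component_of_set X ` topspace X" by blast
  qed
qed

definition cut_components :: "'a topology \<Rightarrow> 'a \<Rightarrow> 'a set set"
  where "cut_components X z = connected_components_of (subtopology X (topspace X - {z}))"

lemma cut_components_eqI:
  assumes "pairwise disjnt \<C>" "\<Union>\<C> = topspace X - {z}"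
    and "\<And>C. C \<in> \<C> \<Longrightarrow> openin X C \<and> connectedin X C \<and> C \<noteq> {}"
  shows "cut_components X z = \<C>"
  unfolding cut_components_def
proof (rule connected_components_of_open_partition[OF assms(1)])
  show "\<Union>\<C> = topspace (subtopology X (topspace X - {z}))" using assms(2) by auto
  fix C assume "C \<in> \<C>"
  moreover from this have "C \<subseteq> topspace X - {z}" using assms(2) by blast
  ultimately show "openin (subtopology X (topspace X - {z})) C \<and>
      connectedin (subtopology X (topspace X - {z})) C \<and> C \<noteq> {}"
    using assms(3)[of C] by (auto simp: connectedin_subtopology openin_subtopology)
qed

lemma homeomorphic_map_cut_components:
  assumes f: "homeomorphic_map X Y f" and z: "z \<in> topspace X"
  shows "cut_components Y (f z) = image f ` cut_components X z"
    and "card (cut_components Y (f z)) = card (cut_components X z)"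
    and "finite (cut_components Y (f z)) = finite (cut_components X z)"
proof -
  have inj: "inj_on f (topspace X)" and im: "f ` topspace X = topspace Y"
    using f by (simp_all add: homeomorphic_imp_injective_map homeomorphic_imp_surjective_map)
  have "f ` (topspace X \<inter> (topspace X - {z})) = topspace Y \<inter> (topspace Y - {f z})"
    using inj im z by (auto simp: inj_on_def)
  from homeomorphic_map_connected_components_of[OF homeomorphic_map_subtopologies[OF f this]]
  show *: "cut_components Y (f z) = image f ` cut_components X z"
    unfolding cut_components_def .
  have "\<Union>(cut_components X z) \<subseteq> topspace X"
    unfolding cut_components_def Union_connected_components_of by auto
  then have "inj_on (image f) (cut_components X z)"
    using inj by (metis inj_on_image inj_on_subset)
  then show "card (cut_components Y (f z)) = card (cut_components X z)"
    "finite (cut_components Y (f z)) = finite (cut_components X z)"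
    unfolding * by (simp_all add: card_image finite_image_iff)
qed

section \<open>Connected subsets of hedgehogs\<close>

context hedgehog
begin

definition spoke_map :: "'i \<Rightarrow> nat \<Rightarrow> 'i pt"
  where "spoke_map i x = (if x = 1 then Center else Spoke i x)"

definition leaf_map :: "'i \<Rightarrow> nat \<Rightarrow> nat \<Rightarrow> nat \<Rightarrow> 'i pt"
  where "leaf_map i x j y = (if y = 1 then Spoke i x else Leaf i x j y)"

lemma continuous_spoke_map:
  assumes i: "i \<in> I"
  shows "continuous_map kirch X (spoke_map i)"
  unfolding continuous_map
proof (intro conjI allI impI)
  show "spoke_map i ` topspace kirch \<subseteq> topspace X" using i by (auto simp: spoke_map_def)
  fix U assume U: "openin X U"
  show "openin kirch {x \<in> topspace kirch. spoke_map i x \<in> U}"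
    unfolding kirch.openin_nbhd_topology
  proof (intro conjI ballI)
    fix x assume x: "x \<in> {x \<in> topspace kirch. spoke_map i x \<in> U}"
    then obtain A b where A: "A \<in> \<Phi>" "squarefree b" "coprime (label (spoke_map i x)) b"
      "Collect (near (spoke_map i x) A b) \<subseteq> U"
      using U unfolding openin_X_iff by blast
    \<comment> \<open>Neighbourhoods of a spoke point omit the centre, so for
      \<open>x \<noteq> 1\<close> the class around \<open>x\<close> has to omit 1; the factor
      \<open>p\<close> achieves this.\<close>
    obtain p where p: "squarefree p" "\<And>k. 0 < k \<Longrightarrow> k \<le> 1 + b + x \<Longrightarrow> coprime k p"
      "\<And>k l. k \<le> 1 + b + x \<Longrightarrow> l \<le> 1 + b + x \<Longrightarrow> [k = l] (mod p) \<Longrightarrow> k = l"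
      using ex_separating_modulus by blast
    have "squarefree (b * p)"
      using A p squarefree_pos[OF A(2)] by (simp add: squarefree_mult_coprime)
    moreover have "coprime x (b * p)"
      using A x p by (auto simp: spoke_map_def split: if_splits)
    moreover have "spoke_map i y \<in> U" if y: "y \<in> kirch_class x (b * p)" for y
    proof -
      have c: "[y = x] (mod b)" "[y = x] (mod p)" and "0 < y"
        using y cong_dvd_modulus_nat[of y x "b * p"] by (auto simp: mem_kirch_class)
      have "x = 1" if "y = 1"
        using that c p(3)[of 1 x] by auto
      then have "near (spoke_map i x) A b (spoke_map i y)"
        using c i \<open>0 < y\<close> by (auto simp: spoke_map_def)
      then show ?thesis using A by blast
    qed
    ultimately show "\<exists>N\<in>kirch_nb x. N \<subseteq> {x \<in> topspace kirch. spoke_map i x \<in> U}"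
      by (intro ex_kirch_nbI[of "b * p"]) (auto simp: mem_kirch_class)
  qed auto
qed

lemma continuous_leaf_map:
  assumes i: "i \<in> I" "2 \<le> x" "j < m i x"
  shows "continuous_map kirch X (leaf_map i x j)"
  unfolding continuous_map
proof (intro conjI allI impI)
  show "leaf_map i x j ` topspace kirch \<subseteq> topspace X" using i by (auto simp: leaf_map_def)
  fix U assume U: "openin X U"
  show "openin kirch {y \<in> topspace kirch. leaf_map i x j y \<in> U}"
    unfolding kirch.openin_nbhd_topology
  proof (intro conjI ballI)
    fix y assume y: "y \<in> {y \<in> topspace kirch. leaf_map i x j y \<in> U}"
    then obtain A b where A: "A \<in> \<Phi>" "squarefree b" "coprime (label (leaf_map i x j y)) b"
      "Collect (near (leaf_map i x j y) A b) \<subseteq> U"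
      using U unfolding openin_X_iff by blast
    obtain p where p: "squarefree p" "\<And>k. 0 < k \<Longrightarrow> k \<le> 1 + b + y \<Longrightarrow> coprime k p"
      "\<And>k l. k \<le> 1 + b + y \<Longrightarrow> l \<le> 1 + b + y \<Longrightarrow> [k = l] (mod p) \<Longrightarrow> k = l"
      using ex_separating_modulus by blast
    have bp: "squarefree (b * p)"
      using A p squarefree_pos[OF A(2)] by (simp add: squarefree_mult_coprime)
    \<comment> \<open>At the foot, \<open>y = 1\<close>, congruence to 1 modulo \<open>b\<close> is
      all that is asked for; elsewhere the factor \<open>p\<close> keeps the foot out of the
      class.\<close>
    define c where "c = (if y = 1 then b else b * p)"
    have "squarefree c" using bp A by (simp add: c_def)
    moreover have "coprime y c"
      using A y p by (auto simp: leaf_map_def c_def split: if_splits)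
    moreover have "leaf_map i x j v \<in> U" if v: "v \<in> kirch_class y c" for v
    proof -
      have b: "[v = y] (mod b)" and "0 < v" 
        using v cong_dvd_modulus_nat[of v y "b * p"] by (auto simp: mem_kirch_class c_def split: if_splits)
      have "y = 1" if "v = 1"
        using that v p(3)[of 1 y] cong_dvd_modulus_nat[of v y "b * p" p]
        by (auto simp: mem_kirch_class c_def split: if_splits)
      then have "near (leaf_map i x j y) A b (leaf_map i x j v)"
        using b i \<open>0 < v\<close> by (auto simp: leaf_map_def)
      then show ?thesis using A by blast
    qed
    ultimately show "\<exists>N\<in>kirch_nb y. N \<subseteq> {y \<in> topspace kirch. leaf_map i x j y \<in> U}"
      by (intro ex_kirch_nbI[of c]) (auto simp: mem_kirch_class)
  qed auto
qed

text \<open>One shape for the connected sets below that are not confined to a leaf: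
  \<open>A i\<close> is the part kept of arm \<open>i\<close>, with 1 standing for the centre, and
  \<open>D i x j\<close> the part kept of a leaf whose foot is kept.\<close>

fun mem_tree :: "'i set \<Rightarrow> ('i \<Rightarrow> nat set) \<Rightarrow> ('i \<Rightarrow> nat \<Rightarrow> nat \<Rightarrow> nat set) \<Rightarrow> 'i pt \<Rightarrow> bool"
  where
    "mem_tree G A D Center \<longleftrightarrow> (\<exists>i\<in>G. 1 \<in> A i)"
  | "mem_tree G A D (Spoke i x) \<longleftrightarrow> i \<in> G \<and> 2 \<le> x \<and> x \<in> A i"
  | "mem_tree G A D (Leaf i x j y) \<longleftrightarrow> i \<in> G \<and> 2 \<le> x \<and> x \<in> A i \<and> j < m i x \<and> 2 \<le> y \<and> y \<in> D i x j"

text \<open>Each leaf part contains its foot and so hangs on its arm part. The arm parts share the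
  centre, unless there is only one, in which case the centre may be missing.\<close>

lemma connectedin_tree:
  assumes G: "G \<subseteq> I"
    and A: "\<And>i. i \<in> G \<Longrightarrow> connectedin kirch (A i)"
    and D: "\<And>i x j. i \<in> G \<Longrightarrow> x \<in> A i \<Longrightarrow> connectedin kirch (D i x j) \<and> 1 \<in> D i x j"
    and one: "(\<forall>i\<in>G. 1 \<in> A i) \<or> (\<exists>i. G = {i})"
  shows "connectedin X (Collect (mem_tree G A D))"
proof -
  define T where "T i = spoke_map i ` A i \<union>
    \<Union>{leaf_map i x j ` D i x j |x j. x \<in> A i \<and> 2 \<le> x \<and> j < m i x}" for i
  \<comment> \<open>Positivity excludes the coordinate 0, so a kept coordinate other than 1 is at
    least 2, as valid points require.\<close>
  have pos: "0 < x" if "i \<in> G" "x \<in> A i" for i x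
    using A[OF that(1)] that connectedin_subset_topspace by fastforce
  have posD: "0 < y" if "i \<in> G" "x \<in> A i" "y \<in> D i x j" for i x j y
    using D[OF that(1,2)] that connectedin_subset_topspace by fastforce
  have T: "connectedin X (T i)" if i: "i \<in> G" for i
    unfolding T_def
  proof (rule connectedin_attach)
    show "connectedin X (spoke_map i ` A i)"
      using G i A connectedin_continuous_map_image[OF continuous_spoke_map] by blast
    fix E assume "E \<in> {leaf_map i x j ` D i x j |x j. x \<in> A i \<and> 2 \<le> x \<and> j < m i x}"
    then obtain x j where E: "E = leaf_map i x j ` D i x j" "x \<in> A i" "2 \<le> x" "j < m i x" by blast
    have "connectedin X E"
      unfolding E using G i D E connectedin_continuous_map_image[OF continuous_leaf_map] by blast
    moreover have "spoke_map i x = leaf_map i x j 1" using E by (simp add: spoke_map_def leaf_map_def)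
    then have "spoke_map i x \<in> E" unfolding E using D[OF i E(2)] by blast
    ultimately show "connectedin X E \<and> spoke_map i ` A i \<inter> E \<noteq> {}" using E by blast
  qed
  have eq: "Collect (mem_tree G A D) = \<Union>(T ` G)"
  proof (intro set_eqI)
    fix w show "w \<in> Collect (mem_tree G A D) \<longleftrightarrow> w \<in> \<Union>(T ` G)"
    proof (cases w)
      case Center
      then show ?thesis by (auto simp: T_def spoke_map_def leaf_map_def image_iff)
    next
      case (Spoke i x)
      show ?thesis
      proof
        assume "w \<in> Collect (mem_tree G A D)"
        then have "w = spoke_map i x" "i \<in> G" "x \<in> A i" using Spoke by (auto simp: spoke_map_def)
        then show "w \<in> \<Union>(T ` G)" unfolding T_def by blast
      next
        assume "w \<in> \<Union>(T ` G)"
        then show "w \<in> Collect (mem_tree G A D)"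
          using Spoke pos[of i x] by (auto simp: T_def spoke_map_def leaf_map_def split: if_splits)
      qed
    next
      case (Leaf i x j y)
      show ?thesis
      proof
        assume "w \<in> Collect (mem_tree G A D)"
        then have "w = leaf_map i x j y" "i \<in> G" "x \<in> A i" "2 \<le> x" "j < m i x" "y \<in> D i x j"
          using Leaf by (auto simp: leaf_map_def)
        then show "w \<in> \<Union>(T ` G)" unfolding T_def by blast
      next
        assume "w \<in> \<Union>(T ` G)"
        then show "w \<in> Collect (mem_tree G A D)"
          using Leaf posD[of i x y j] by (auto simp: T_def spoke_map_def leaf_map_def split: if_splits)
      qed
    qed
  qed
  from one show ?thesis
  proof
    assume "\<forall>i\<in>G. 1 \<in> A i"
    then have c: "Center \<in> T i" if "i \<in> G" for i
      using that unfolding T_def spoke_map_def by force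
    show ?thesis
    proof (cases "G = {}")
      case True
      then show ?thesis using eq by (metis connectedin_empty image_empty Union_empty)
    next
      case False
      then have "connectedin X (\<Union>(T ` G))"
        using T c by (intro connectedin_Union) blast+
      then show ?thesis using eq by simp
    qed
  next
    assume "\<exists>i. G = {i}"
    then show ?thesis using T eq by auto
  qed
qed

end

text \<open>The leaf counts occurring on an arm are its fingerprint. The number 0 is inserted
  because it is visible on every arm: a point inside a leaf, like a spoke point without leaves, is
  no cut point. An infinite \<open>I\<close> singles out the centre.\<close>

locale rigid_hedgehog = hedgehog +
  assumes infinite_I: "infinite I"
    and inj_leaves: "inj_on (\<lambda>i. insert 0 (m i ` {2..})) I"
begin

lemma I_nonempty: "I \<noteq> {}"
  using infinite_I by auto

lemma connectedin_kirch_full: "connectedin kirch {0<..}" "connectedin kirch ({0<..} - {x})"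
  using connectedin_kirch_cofinite[of "{}"] connectedin_kirch_cofinite[of "{x}"] by auto

lemma connectedin_kirch_class:
  assumes "0 < x" "squarefree b" "coprime x b"
  shows "connectedin kirch (kirch_class x b)" "connectedin kirch (kirch_class x b - {y})"
  using connectedin_kirch[OF assms, of "{}"] connectedin_kirch[OF assms, of "{y}"] by auto

abbreviation full :: "'a \<Rightarrow> nat \<Rightarrow> nat \<Rightarrow> nat set" where "full i x j \<equiv> {0<..}"

lemma connected_X: "connected_space X"
proof -
  have "topspace X = Collect (mem_tree I (\<lambda>_. {0<..}) full)" (is "_ = ?T")
  proof (intro set_eqI)
    fix w show "w \<in> topspace X \<longleftrightarrow> w \<in> ?T" using I_nonempty by (cases w) auto
  qed
  moreover have "connectedin X ?T"
    by (intro connectedin_tree) (auto simp: connectedin_kirch_full)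
  ultimately show ?thesis by (metis connectedin_topspace)
qed

text \<open>Written as trees or leaf pieces, these sets reduce to residue classes, possibly without
  the point 1. The deletion of 1 keeps out the gluing point, which is not near a spoke or leaf
  point.\<close>

lemma connectedin_near:
  assumes z: "valid z" and b: "squarefree b" "coprime (label z) b"
  shows "connectedin X (Collect (near z A b))"
proof (cases z)
  case Center
  have "Collect (near z A b) =
    Collect (mem_tree I (\<lambda>i. if i \<in> A then {0<..} else kirch_class 1 b) full)" (is "?L = ?R")
  proof (intro set_eqI)
    fix w show "w \<in> ?L \<longleftrightarrow> w \<in> ?R"
      using I_nonempty unfolding Center by (cases w) (auto simp: mem_kirch_class)
  qed
  moreover have "connectedin X ?R"
    using b by (intro connectedin_tree)
      (auto simp: connectedin_kirch_full mem_kirch_class intro!: connectedin_kirch_class)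
  ultimately show ?thesis by simp
next
  case (Spoke i x)
  have "Collect (near z A b) =
    Collect (mem_tree {i} (\<lambda>_. kirch_class x b - {1}) (\<lambda>_ x' _. if x' = x then kirch_class 1 b else {0<..}))" (is "?L = ?R")
  proof (intro set_eqI)
    fix w show "w \<in> ?L \<longleftrightarrow> w \<in> ?R"
      using z unfolding Spoke by (cases w) (auto simp: mem_kirch_class)
  qed
  moreover have "connectedin X ?R"
    using b z Spoke by (intro connectedin_tree)
      (auto simp: connectedin_kirch_full mem_kirch_class intro!: connectedin_kirch_class)
  ultimately show ?thesis by simp
next
  case (Leaf i x j y)
  have "Collect (near z A b) = leaf_map i x j ` (kirch_class y b - {1})" (is "?L = ?R")
  proof (intro set_eqI)
    fix w show "w \<in> ?L \<longleftrightarrow> w \<in> ?R"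
      unfolding Leaf by (cases w) (auto simp: mem_kirch_class leaf_map_def image_iff)
  qed
  moreover have "connectedin X ?R"
    using b z Leaf
    by (intro connectedin_continuous_map_image[OF continuous_leaf_map] connectedin_kirch_class) auto
  ultimately show ?thesis by simp
qed

lemma locally_connected_X: "locally_connected_space X"
  unfolding locally_connected_space
proof (intro allI impI, elim conjE)
  fix V z assume V: "openin X V" "z \<in> V"
  then have z: "valid z" using openin_X_iff by auto
  obtain A b where A: "A \<in> \<Phi>" "squarefree b" "coprime (label z) b" "Collect (near z A b) \<subseteq> V"
    using V unfolding openin_X_iff by blast
  show "\<exists>U. openin X U \<and> connectedin X U \<and> z \<in> U \<and> U \<subseteq> V"
  proof (intro exI conjI)
    show "openin X (Collect (near z A b))" using A z by (intro openin_near)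
    show "connectedin X (Collect (near z A b))" using A z by (intro connectedin_near)
    show "z \<in> Collect (near z A b)" using near_refl[OF z] by simp
  qed (rule A(4))
qed

lemma clc_Hausdorff_X: "clc_Hausdorff X"
  unfolding clc_Hausdorff_def using connected_X locally_connected_X Hausdorff_X by blast

lemma openin_by_near:
  assumes "U \<subseteq> points"
    and "\<And>z. z \<in> U \<Longrightarrow> \<exists>A\<in>\<Phi>. \<exists>b. squarefree b \<and> coprime (label z) b \<and> (\<forall>w. near z A b w \<longrightarrow> w \<in> U)"
  shows "openin X U"
proof -
  have "Collect (near z A b) \<subseteq> U \<longleftrightarrow> (\<forall>w. near z A b w \<longrightarrow> w \<in> U)" for z A b by auto
  then show ?thesis unfolding openin_X_iff using assms by simp
qed

lemma near_1I:
  assumes "\<And>w A. near z A 1 w \<Longrightarrow> w \<in> U"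
  shows "\<exists>A\<in>\<Phi>. \<exists>b. squarefree b \<and> coprime (label z) b \<and> (\<forall>w. near z A b w \<longrightarrow> w \<in> U)"
proof -
  obtain A where "A \<in> \<Phi>" using \<Phi>_nonempty by blast
  then show ?thesis using assms by (intro bexI[of _ A] exI[of _ 1]) auto
qed

section \<open>Components left by the removal of a point\<close>

definition arm :: "'a \<Rightarrow> 'a pt set"
  where "arm i = {w. valid w \<and> arm_of w = {i}}"

lemma mem_arm [simp]:
  "Center \<notin> arm i" "Spoke i' x \<in> arm i \<longleftrightarrow> valid (Spoke i' x) \<and> i' = i"
  "Leaf i' x j y \<in> arm i \<longleftrightarrow> valid (Leaf i' x j y) \<and> i' = i"
  by (auto simp: arm_def)

lemma arm_subset: "arm i \<subseteq> points"
  by (auto simp: arm_def)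

text \<open>With modulus 1 the neighbourhoods of an arm point stay in its arm, so arms are open;
  each is connected because removing 1 does not disconnect the Kirch space.\<close>

lemma cut_components_Center: "cut_components X Center = arm ` I"
proof (rule cut_components_eqI)
  show "pairwise disjnt (arm ` I)"
    by (auto simp: pairwise_def disjnt_def arm_def)
  show "\<Union>(arm ` I) = topspace X - {Center}"
  proof (intro set_eqI)
    fix w show "w \<in> \<Union>(arm ` I) \<longleftrightarrow> w \<in> topspace X - {Center}" by (cases w) auto
  qed
  fix C assume "C \<in> arm ` I"
  then obtain i where i: "i \<in> I" "C = arm i" by blast
  have "openin X (arm i)"
  proof (rule openin_by_near[OF arm_subset])
    fix z assume z: "z \<in> arm i"
    show "\<exists>A\<in>\<Phi>. \<exists>b. squarefree b \<and> coprime (label z) b \<and> (\<forall>w. near z A b w \<longrightarrow> w \<in> arm i)"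
    proof (rule near_1I)
      fix w A assume "near z A 1 w"
      then show "w \<in> arm i" using z by (cases z; cases w) auto
    qed
  qed
  moreover have "arm i = Collect (mem_tree {i} (\<lambda>_. {0<..} - {1}) full)" (is "_ = ?T")
  proof (intro set_eqI)
    fix w show "w \<in> arm i \<longleftrightarrow> w \<in> ?T" using i by (cases w) auto
  qed
  moreover have "connectedin X ?T"
    using i by (intro connectedin_tree) (auto simp: connectedin_kirch_full)
  moreover have "Spoke i 2 \<in> arm i" using i by simp
  ultimately show "openin X C \<and> connectedin X C \<and> C \<noteq> {}" using i by (metis empty_iff)
qed

lemma infinite_cut_components_Center: "infinite (cut_components X Center)"
proof -
  have "inj_on arm I"
  proof (rule inj_onI)
    fix i i' assume "i \<in> I" "i' \<in> I" "arm i = arm i'"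
    moreover from this have "Spoke i 2 \<in> arm i'" by (metis mem_arm(2) order_refl valid.simps(2))
    ultimately show "i = i'" by simp
  qed
  then show ?thesis
    unfolding cut_components_Center using infinite_I by (simp add: finite_image_iff)
qed

definition leaf :: "'a \<Rightarrow> nat \<Rightarrow> nat \<Rightarrow> 'a pt set"
  where "leaf i x j = {Leaf i x j y |y. 2 \<le> y}"

text \<open>Each leaf is cut off at its foot. The remainder \<open>R\<close> hangs together through
  the centre, since arm \<open>i\<close> without \<open>x\<close> is still connected.\<close>

lemma cut_components_Spoke:
  assumes i: "i \<in> I" "2 \<le> x"
  defines "R \<equiv> {w. valid w \<and> w \<noteq> Spoke i x \<and> (\<forall>j y. w \<noteq> Leaf i x j y)}"
  shows "cut_components X (Spoke i x) = insert R (leaf i x ` {..<m i x})"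
proof (rule cut_components_eqI)
  show "pairwise disjnt (insert R (leaf i x ` {..<m i x}))"
    by (auto simp: pairwise_def disjnt_def leaf_def R_def)
  show "\<Union>(insert R (leaf i x ` {..<m i x})) = topspace X - {Spoke i x}"
  proof (intro set_eqI)
    fix w show "w \<in> \<Union>(insert R (leaf i x ` {..<m i x})) \<longleftrightarrow> w \<in> topspace X - {Spoke i x}"
      using i by (cases w) (auto simp: leaf_def R_def)
  qed
  have R: "openin X R \<and> connectedin X R \<and> R \<noteq> {}"
  proof (intro conjI)
    show "R \<noteq> {}" unfolding R_def using valid.simps(1) by blast
    show "openin X R"
    proof (rule openin_by_near)
      show "R \<subseteq> points" unfolding R_def by auto
      fix z assume z: "z \<in> R"
      \<comment> \<open>The modulus \<open>p\<close> tells \<open>x\<close> apart from the height of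
        \<open>z\<close>, and \<open>A\<close> prevents a neighbourhood of the centre from filling
        arm \<open>i\<close>; so \<open>Spoke i x\<close> and its leaves are avoided.\<close>
      obtain p where p: "squarefree p" "\<And>k. 0 < k \<Longrightarrow> k \<le> x + height z \<Longrightarrow> coprime k p"
        "\<And>k l. k \<le> x + height z \<Longrightarrow> l \<le> x + height z \<Longrightarrow> [k = l] (mod p) \<Longrightarrow> k = l"
        using ex_separating_modulus by blast
      obtain A where A: "A \<in> \<Phi>" "i \<notin> A" using \<Phi>_free i by blast
      show "\<exists>A\<in>\<Phi>. \<exists>b. squarefree b \<and> coprime (label z) b \<and> (\<forall>w. near z A b w \<longrightarrow> w \<in> R)"
      proof (cases z)
        case Center
        have "\<not> [x = 1] (mod p)" using p(3)[of x 1] i Center by auto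
        then have "w \<in> R" if "near z A p w" for w
          using that A unfolding R_def Center by (cases w) auto
        then show ?thesis using A p(1) Center by auto
      next
        case (Spoke i' x')
        show ?thesis
        proof (cases "i' = i")
          case True
          then have "\<not> [x = x'] (mod p)" using p(3)[of x x'] i z Spoke by (auto simp: R_def)
          then have "w \<in> R" if "near z A p w" for w
            using that z unfolding R_def Spoke by (cases w) auto
          moreover have "coprime (label z) p" using p(2)[of x'] z Spoke by (auto simp: R_def)
          ultimately show ?thesis using A p(1) by blast
        next
          case False
          show ?thesis
          proof (rule near_1I)
            fix w A assume "near z A 1 w"
            then show "w \<in> R" using z False unfolding R_def Spoke by (cases w) auto
          qed
        qed
      next
        case (Leaf i' x' j y)
        show ?thesis
        proof (rule near_1I)
          fix w A assume "near z A 1 w"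
          then show "w \<in> R" using z unfolding R_def Leaf by (cases w) auto
        qed
      qed
    qed
    have "R = Collect (mem_tree I (\<lambda>i'. if i' = i then {0<..} - {x} else {0<..}) full)" (is "_ = ?T")
    proof (intro set_eqI)
      fix w show "w \<in> R \<longleftrightarrow> w \<in> ?T" using i I_nonempty unfolding R_def by (cases w) auto
    qed
    moreover have "connectedin X ?T"
      using i by (intro connectedin_tree) (auto simp: connectedin_kirch_full)
    ultimately show "connectedin X R" by simp
  qed
  have L: "openin X (leaf i x j) \<and> connectedin X (leaf i x j) \<and> leaf i x j \<noteq> {}" if j: "j < m i x" for j
  proof (intro conjI)
    show "leaf i x j \<noteq> {}" unfolding leaf_def by auto
    show "openin X (leaf i x j)"
    proof (rule openin_by_near)
      show "leaf i x j \<subseteq> points" using i j by (auto simp: leaf_def)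
      fix z assume z: "z \<in> leaf i x j"
      show "\<exists>A\<in>\<Phi>. \<exists>b. squarefree b \<and> coprime (label z) b \<and> (\<forall>w. near z A b w \<longrightarrow> w \<in> leaf i x j)"
      proof (rule near_1I)
        fix w A assume "near z A 1 w"
        then show "w \<in> leaf i x j" using z by (cases z; cases w) (auto simp: leaf_def)
      qed
    qed
    have "leaf i x j = leaf_map i x j ` ({0<..} - {1})" (is "_ = ?T")
    proof (intro set_eqI)
      fix w show "w \<in> leaf i x j \<longleftrightarrow> w \<in> ?T"
        by (cases w) (auto simp: leaf_def leaf_map_def image_iff)
    qed
    moreover have "connectedin X ?T"
      using i j by (intro connectedin_continuous_map_image[OF continuous_leaf_map] connectedin_kirch_full) auto
    ultimately show "connectedin X (leaf i x j)" by simp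
  qed
  fix C assume "C \<in> insert R (leaf i x ` {..<m i x})"
  then show "openin X C \<and> connectedin X C \<and> C \<noteq> {}" using R L by auto
qed

lemma card_cut_components_Spoke:
  assumes i: "i \<in> I" "2 \<le> x"
  shows "finite (cut_components X (Spoke i x))" "card (cut_components X (Spoke i x)) = Suc (m i x)"
proof -
  have "inj_on (leaf i x) {..<m i x}"
  proof (rule inj_onI)
    fix j j' assume "leaf i x j = leaf i x j'"
    moreover have "Leaf i x j 2 \<in> leaf i x j" by (simp add: leaf_def)
    ultimately have "Leaf i x j 2 \<in> leaf i x j'" by simp
    then show "j = j'" by (simp add: leaf_def)
  qed
  moreover have "{w. valid w \<and> w \<noteq> Spoke i x \<and> (\<forall>j y. w \<noteq> Leaf i x j y)} \<notin> leaf i x ` {..<m i x}" (is "?R \<notin> _")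
  proof
    assume "?R \<in> leaf i x ` {..<m i x}"
    then obtain j where "?R = leaf i x j" by blast
    moreover have "Center \<in> ?R" by simp
    ultimately have "Center \<in> leaf i x j" by simp
    then show False by (simp add: leaf_def)
  qed
  ultimately show "finite (cut_components X (Spoke i x))" "card (cut_components X (Spoke i x)) = Suc (m i x)"
    unfolding cut_components_Spoke[OF i] by (simp_all add: card_image)
qed

text \<open>A leaf without one point other than its foot stays connected and attached, so nothing is
  cut off.\<close>

lemma cut_components_Leaf:
  assumes z: "valid (Leaf i x j y)"
  shows "cut_components X (Leaf i x j y) = {points - {Leaf i x j y}}"
proof (rule cut_components_eqI)
  have "openin X (points - {Leaf i x j y})"
    using Hausdorff_X z by (metis Hausdorff_imp_t1_space mem_points openin_diff openin_topspace closedin_t1_singleton topspace_nbhd_topology)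
  moreover have "Center \<in> points - {Leaf i x j y}" by simp
  moreover have "connectedin X (points - {Leaf i x j y})"
  proof -
    have "points - {Leaf i x j y} =
      Collect (mem_tree I (\<lambda>_. {0<..}) (\<lambda>i' x' j'. if (i',x',j') = (i,x,j) then {0<..} - {y} else {0<..}))" (is "?L = ?T")
    proof (intro set_eqI)
      fix w show "w \<in> ?L \<longleftrightarrow> w \<in> ?T" using z I_nonempty by (cases w) auto
    qed
    moreover have "connectedin X ?T"
      using z by (intro connectedin_tree) (auto simp: connectedin_kirch_full)
    ultimately show ?thesis by simp
  qed
  moreover fix C assume "C \<in> {points - {Leaf i x j y}}"
  ultimately show "openin X C \<and> connectedin X C \<and> C \<noteq> {}" by blast
qed auto

lemma infinite_cut_components_iff:
  assumes "valid z"
  shows "infinite (cut_components X z) \<longleftrightarrow> z = Center"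
  using assms infinite_cut_components_Center card_cut_components_Spoke cut_components_Leaf
  by (cases z) auto

lemma card_cut_components_arm:
  assumes i: "i \<in> I"
  shows "(\<lambda>z. card (cut_components X z)) ` arm i = Suc ` insert 0 (m i ` {2..})" (is "?c ` _ = ?R")
proof (intro equalityI subsetI)
  fix n assume "n \<in> ?c ` arm i"
  then obtain z where "z \<in> arm i" "n = ?c z" by blast
  then show "n \<in> ?R"
    using card_cut_components_Spoke cut_components_Leaf by (cases z) auto
next
  fix n assume "n \<in> ?R"
  \<comment> \<open>The value \<open>Suc 0\<close> needs its own witness: a spoke point if the arm
    has no leaves, otherwise a point inside a leaf.\<close>
  then consider "n = Suc 0" "\<forall>x\<ge>2. m i x = 0" | x where "n = Suc 0" "2 \<le> x" "0 < m i x"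
    | x where "n = Suc (m i x)" "2 \<le> x" by fastforce
  then show "n \<in> ?c ` arm i"
  proof cases
    case 1
    then have "n = ?c (Spoke i 2)" "Spoke i 2 \<in> arm i"
      using card_cut_components_Spoke[OF i, of 2] i by auto
    then show ?thesis by blast
  next
    case 2
    then have "n = ?c (Leaf i x 0 2)" "Leaf i x 0 2 \<in> arm i"
      using cut_components_Leaf[of i x 0 2] i by auto
    then show ?thesis by blast
  next
    case 3
    then have "n = ?c (Spoke i x)" "Spoke i x \<in> arm i"
      using card_cut_components_Spoke[OF i, of x] i by auto
    then show ?thesis by blast
  qed
qed

lemma arm_eq_imp:
  assumes "i \<in> I" "i' \<in> I"
    and "(\<lambda>z. card (cut_components X z)) ` arm i = (\<lambda>z. card (cut_components X z)) ` arm i'"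
  shows "i = i'"
proof -
  have "Suc ` insert 0 (m i ` {2..}) = Suc ` insert 0 (m i' ` {2..})"
    using assms(3) unfolding card_cut_components_arm[OF assms(1)] card_cut_components_arm[OF assms(2)] .
  then have "insert 0 (m i ` {2..}) = insert 0 (m i' ` {2..})"
    by (simp only: inj_image_eq_iff[OF inj_Suc])
  then show ?thesis using inj_leaves assms(1,2) by (meson inj_onD)
qed

section \<open>Recovering the filter from the topology\<close>

lemma arms_in_neighbourhood:
  assumes "openin X U" "Center \<in> U"
  obtains A where "A \<in> \<Phi>" "\<And>i. i \<in> I \<Longrightarrow> i \<in> A \<Longrightarrow> arm i \<subseteq> U"
proof -
  obtain A b where A: "A \<in> \<Phi>" "Collect (near Center A b) \<subseteq> U"
    using assms unfolding openin_X_iff by blast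
  have "arm i \<subseteq> U" if "i \<in> I" "i \<in> A" for i
  proof
    fix w assume "w \<in> arm i"
    then have "near Center A b w" using that by (cases w) auto
    then show "w \<in> U" using A by blast
  qed
  then show ?thesis using A that by blast
qed

text \<open>Together with \<open>arms_in_neighbourhood\<close> this makes the traces of filter sets
  on \<open>I\<close> mutually cofinal with the families of arms contained in neighbourhoods of the
  centre.\<close>

lemma neighbourhood_of_arms:
  assumes "A \<in> \<Phi>"
  obtains U where "openin X U" "Center \<in> U" "\<And>i. i \<in> I \<Longrightarrow> arm i \<subseteq> U \<Longrightarrow> i \<in> A"
proof
  \<comment> \<open>Modulo 2 the number 2 is not congruent to 1, so \<open>Spoke i 2\<close> lies in
    this neighbourhood only if \<open>i \<in> A\<close>.\<close>
  have "squarefree (2::nat)" by (simp add: squarefree_prime)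
  then show "openin X (Collect (near Center A 2))" using assms by (intro openin_near) auto
  show "Center \<in> Collect (near Center A 2)" by simp
  fix i assume i: "i \<in> I" "arm i \<subseteq> Collect (near Center A 2)"
  moreover have "Spoke i 2 \<in> arm i" using i by simp
  ultimately have "near Center A 2 (Spoke i 2)" by blast
  then show "i \<in> A" by (simp add: cong_def)
qed

end

subsection \<open>Rigidity and weight\<close>

text \<open>Only the removal of the centre leaves infinitely many components. Hence arms go to arms,
  and the preserved component counts along an arm identify it.\<close>

lemma homeomorphic_map_arms:
  assumes "rigid_hedgehog I m \<Phi>" "rigid_hedgehog I m \<Psi>"
    and f: "homeomorphic_map (hedgehog.X I m \<Phi>) (hedgehog.X I m \<Psi>) f"
  shows "f Center = Center" and "i \<in> I \<Longrightarrow> f ` rigid_hedgehog.arm I m i = rigid_hedgehog.arm I m i"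
proof -
  interpret h: rigid_hedgehog I m \<Phi> by (rule assms(1))
  interpret h': rigid_hedgehog I m \<Psi> by (rule assms(2))
  have f_valid: "h.valid (f z)" if "h.valid z" for z
    using homeomorphic_imp_surjective_map[OF f] that by auto
  note cut = homeomorphic_map_cut_components[OF f]
  show c: "f Center = Center"
    using cut(3)[of Center] h.infinite_cut_components_Center
      h'.infinite_cut_components_iff[of "f Center"] f_valid[of Center] by simp
  assume i: "i \<in> I"
  have "image f ` (h.arm ` I) = h'.arm ` I"
    using cut(1)[of Center] h.cut_components_Center h'.cut_components_Center by (simp add: c)
  then have "f ` h.arm i \<in> h'.arm ` I" using i by blast
  then obtain i' where i': "i' \<in> I" "f ` h.arm i = h'.arm i'" by blast
  have "(\<lambda>z. card (cut_components h'.X z)) ` h'.arm i' =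
      (\<lambda>z. card (cut_components h'.X (f z))) ` h.arm i"
    unfolding i'(2)[symmetric] by (simp add: image_image)
  also have "\<dots> = (\<lambda>z. card (cut_components h.X z)) ` h.arm i"
    using h.arm_subset by (intro image_cong refl cut(2)) (auto simp: h.arm_def)
  also have "\<dots> = (\<lambda>z. card (cut_components h'.X z)) ` h'.arm i"
    unfolding h.card_cut_components_arm[OF i] h'.card_cut_components_arm[OF i] ..
  finally have "i' = i" using h'.arm_eq_imp[OF i'(1) i] by blast
  then show "f ` h.arm i = h'.arm i" using i' by simp
qed

text \<open>A neighbourhood of the centre and its image contain the same arms, because every arm is
  mapped to itself.\<close>

lemma homeomorphic_map_refines:
  assumes "rigid_hedgehog I m \<Phi>" "rigid_hedgehog I m \<Psi>"
    and f: "homeomorphic_map (hedgehog.X I m \<Phi>) (hedgehog.X I m \<Psi>) f" and A: "A \<in> \<Phi>"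
  shows "\<exists>B\<in>\<Psi>. I \<inter> B \<subseteq> A"
proof -
  interpret h: rigid_hedgehog I m \<Phi> by (rule assms(1))
  interpret h': rigid_hedgehog I m \<Psi> by (rule assms(2))
  note arms = homeomorphic_map_arms[OF assms(1-3)]
  obtain U where U: "openin h.X U" "Center \<in> U" "\<And>i. i \<in> I \<Longrightarrow> h.arm i \<subseteq> U \<Longrightarrow> i \<in> A"
    using h.neighbourhood_of_arms[OF A] by blast
  have Usub: "U \<subseteq> topspace h.X" using U(1) by (rule openin_subset)
  have inj: "inj_on f (topspace h.X)" using f by (rule homeomorphic_imp_injective_map)
  have "openin h'.X (f ` U)" using homeomorphic_map_openness[OF f Usub] U(1) by blast
  moreover have "Center \<in> f ` U" using U(2) arms(1) by (metis imageI)
  ultimately obtain B where B: "B \<in> \<Psi>" "\<And>i. i \<in> I \<Longrightarrow> i \<in> B \<Longrightarrow> h'.arm i \<subseteq> f ` U"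
    using h'.arms_in_neighbourhood by blast
  have "i \<in> A" if i: "i \<in> I" "i \<in> B" for i
  proof (rule U(3)[OF i(1)])
    have "f ` h.arm i \<subseteq> f ` U" using B(2)[OF i] arms(2)[OF i(1)] by simp
    moreover have "h.arm i \<subseteq> topspace h.X" using h.arm_subset by simp
    ultimately show "h.arm i \<subseteq> U" using inj_on_image_subset_iff[OF inj] Usub by blast
  qed
  then show ?thesis using B(1) by blast
qed

lemma is_base_iff:
  "is_base X \<B> \<longleftrightarrow> (\<forall>V\<in>\<B>. openin X V) \<and> (\<forall>U x. openin X U \<and> x \<in> U \<longrightarrow> (\<exists>V\<in>\<B>. x \<in> V \<and> V \<subseteq> U))"
  unfolding is_base_def openin_topology_base_unique by blast

section \<open>Cardinal bounds\<close>

lemma card_of_finite_le_infinite: "finite A \<Longrightarrow> infinite B \<Longrightarrow> |A| \<le>o |B|"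
  using finite_iff_ordLess_natLeq infinite_iff_natLeq_ordLeq ordLess_imp_ordLeq ordLeq_transitive by metis

lemma card_of_Times_le_infinite:
  "infinite C \<Longrightarrow> |A| \<le>o |C| \<Longrightarrow> |B| \<le>o |C| \<Longrightarrow> |A \<times> B| \<le>o |C|"
  using card_of_Times_ordLeq_infinite_Field[of "|C|" A B] card_of_Card_order[of C]
  by (metis Field_card_of)

lemma countable_imp_card_of_le: "countable A \<Longrightarrow> |A| \<le>o natLeq"
proof -
  assume "countable A"
  then obtain f :: "'a \<Rightarrow> nat" where "inj_on f A" by (rule countableE)
  then have "|A| \<le>o |UNIV :: nat set|" by (rule card_of_ordLeqI) simp
  then show ?thesis using card_of_nat ordLeq_ordIso_trans by blast
qed

text \<open>Layer by size: a set of \<open>Suc n\<close> elements arises by inserting one element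
  into a set of \<open>n\<close> elements, so no layer exceeds \<open>|A|\<close>, and the layers
  are countably many.\<close>

lemma card_of_Fpow_le:
  assumes A: "infinite A"
  shows "|Fpow A| \<le>o |A|"
proof -
  define G where "G n = {X. X \<subseteq> A \<and> finite X \<and> card X = n}" for n :: nat
  have G: "|G n| \<le>o |A|" for n
  proof (induction n)
    case 0
    have "G 0 \<subseteq> {{}}" unfolding G_def by auto
    then show ?case using A by (intro card_of_finite_le_infinite) (auto intro: finite_subset)
  next
    case (Suc n)
    have "G (Suc n) \<subseteq> (\<lambda>(a, X). insert a X) ` (A \<times> G n)"
    proof
      fix X assume "X \<in> G (Suc n)"
      then have X: "X \<subseteq> A" "finite X" "card X = Suc n" unfolding G_def by auto
      then obtain a Y where "X = insert a Y" "a \<notin> Y" "card Y = n" by (metis card_Suc_eq)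
      then have "(a, Y) \<in> A \<times> G n" "X = (\<lambda>(a, X). insert a X) (a, Y)"
        using X unfolding G_def by auto
      then show "X \<in> (\<lambda>(a, X). insert a X) ` (A \<times> G n)" by (rule rev_image_eqI)
    qed
    then have "|G (Suc n)| \<le>o |A \<times> G n|" by (rule surj_imp_ordLeq)
    then show ?case
      using card_of_Times_le_infinite[OF A card_of_mono1[OF order_refl] Suc] ordLeq_transitive by blast
  qed
  have "Fpow A = (\<Union>n\<in>UNIV. G n)" unfolding Fpow_def G_def by auto
  then show ?thesis
    using card_of_UNION_ordLeq_infinite[OF A, of UNIV G] G A infinite_iff_card_of_nat by metis
qed

section \<open>Size and weight of rigid hedgehogs\<close>

context rigid_hedgehog
begin

lemma card_points: "|points| =o |I|"
proof -
  \<comment> \<open>A point is coded by an arm and a list of naturals whose length, 0, 1 or 3,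
    selects the constructor; other lists default to the centre.\<close>
  define g :: "'a \<times> nat list \<Rightarrow> 'a pt" where
    "g = (\<lambda>(i, ns). case ns of [] \<Rightarrow> Center | [x] \<Rightarrow> Spoke i x | [x, j, y] \<Rightarrow> Leaf i x j y | _ \<Rightarrow> Center)"
  have "points \<subseteq> g ` (I \<times> UNIV)"
  proof
    fix z assume z: "z \<in> points"
    obtain i0 where i0: "i0 \<in> I" using I_nonempty by blast
    show "z \<in> g ` (I \<times> UNIV)"
    proof (cases z)
      case Center
      then have "z = g (i0, [])" by (simp add: g_def)
      then show ?thesis using i0 by blast
    next
      case (Spoke i x)
      then have "z = g (i, [x])" "i \<in> I" using z by (simp_all add: g_def)
      then show ?thesis by blast
    next
      case (Leaf i x j y)
      then have "z = g (i, [x, j, y])" "i \<in> I" using z by (simp_all add: g_def)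
      then show ?thesis by blast
    qed
  qed
  then have "|points| \<le>o |I \<times> (UNIV :: nat list set)|" by (rule surj_imp_ordLeq)
  moreover have "|UNIV :: nat list set| \<le>o |I|"
    using countable_imp_card_of_le[of "UNIV :: nat list set", OF countableI_type] infinite_I infinite_iff_natLeq_ordLeq
      ordLeq_transitive by blast
  ultimately have "|points| \<le>o |I|"
    using card_of_Times_le_infinite[OF infinite_I card_of_mono1[OF order_refl]] ordLeq_transitive by blast
  moreover have "|I| \<le>o |points|"
    by (rule card_of_ordLeqI[of "\<lambda>i. Spoke i 2"]) (auto simp: inj_on_def)
  ultimately show ?thesis by (simp add: ordIso_iff_ordLeq)
qed

lemma weight_le_card:
  assumes C: "infinite C" "|I| \<le>o |C|" "|\<Phi>| \<le>o |C|"
  shows "weight X \<le>o |C|"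
proof -
  have "(\<Union>z\<in>points. nb z) \<subseteq> (\<lambda>(z, A, b). Collect (near z A b)) ` (points \<times> \<Phi> \<times> UNIV)"
    unfolding nb_def by force
  then have "|\<Union>z\<in>points. nb z| \<le>o |points \<times> \<Phi> \<times> (UNIV :: nat set)|" by (rule surj_imp_ordLeq)
  moreover have "|points| \<le>o |C|" using card_points C(2) ordIso_ordLeq_trans by blast
  moreover have "|UNIV :: nat set| \<le>o |C|" using C(1) infinite_iff_card_of_nat by blast
  ultimately have "|\<Union>z\<in>points. nb z| \<le>o |C|"
    using ordLeq_transitive card_of_Times_le_infinite[OF C(1) _ card_of_Times_le_infinite[OF C(1) C(3)]]
    by blast
  then show ?thesis using weight_le[OF is_base_nb] ordLeq_transitive by blast
qed

text \<open>For lower bounds on the weight: each base set around the centre contributes a filter set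
  whose arms it contains, and these filter sets are cofinal.\<close>

lemma base_cofinal:
  assumes B: "is_base X \<B>"
  obtains g where "\<And>U. g U \<in> \<Phi>" "\<And>A. A \<in> \<Phi> \<Longrightarrow> \<exists>U\<in>\<B>. I \<inter> g U \<subseteq> A"
proof -
  \<comment> \<open>Any \<open>U\<close> that is not a base set around the centre gets an arbitrary
    filter set as default.\<close>
  have "\<exists>A\<in>\<Phi>. U \<in> \<B> \<and> Center \<in> U \<longrightarrow> (\<forall>i\<in>I \<inter> A. arm i \<subseteq> U)" for U
  proof (cases "U \<in> \<B> \<and> Center \<in> U")
    case True
    then have "openin X U" "Center \<in> U" using B unfolding is_base_iff by auto
    then show ?thesis using arms_in_neighbourhood by (metis Int_iff)
  next
    case False
    then show ?thesis using \<Phi>_nonempty by blast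
  qed
  then obtain g where g: "\<And>U. g U \<in> \<Phi>"
    "\<And>U i. U \<in> \<B> \<Longrightarrow> Center \<in> U \<Longrightarrow> i \<in> I \<Longrightarrow> i \<in> g U \<Longrightarrow> arm i \<subseteq> U" by (metis Int_iff)
  have "\<exists>U\<in>\<B>. I \<inter> g U \<subseteq> A" if A: "A \<in> \<Phi>" for A
  proof -
    obtain V where V: "openin X V" "Center \<in> V" "\<And>i. i \<in> I \<Longrightarrow> arm i \<subseteq> V \<Longrightarrow> i \<in> A"
      using neighbourhood_of_arms[OF A] by blast
    obtain U where U: "U \<in> \<B>" "Center \<in> U" "U \<subseteq> V" using B V(1,2) unfolding is_base_iff by blast
    have "I \<inter> g U \<subseteq> A" 
    proof
      fix i assume "i \<in> I \<inter> g U"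
      then show "i \<in> A" using g(2)[OF U(1,2), of i] V(3)[of i] U(3) by auto
    qed
    then show ?thesis using U(1) by blast
  qed
  then show ?thesis using g(1) that by blast
qed

end

subsection \<open>Filters from an independent family\<close>

text \<open>The Fichtenholz--Kantorovich independent family, indexed by the subsets \<open>Y\<close> of \<open>J\<close>.\<close>

definition indep_index :: "'a set \<Rightarrow> ('a set \<times> 'a set set) set"
  where "indep_index J = Fpow J \<times> Fpow (Fpow J)"

definition indep :: "'a set \<Rightarrow> ('a set \<times> 'a set set) set"
  where "indep Y = {(a, B). Y \<inter> a \<in> B}"

text \<open>Deleting finite sets \<open>E\<close> from the finite intersections makes the generated
  filter free.\<close>

definition indep_basic :: "'a set \<Rightarrow> 'a set set \<Rightarrow> ('a set \<times> 'a set set) set \<Rightarrow> ('a set \<times> 'a set set) set"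
  where "indep_basic J \<Xi> E = {i \<in> indep_index J. (\<forall>Y\<in>\<Xi>. i \<in> indep Y) \<and> i \<notin> E}"

definition indep_filter_base :: "'a set \<Rightarrow> 'a set set \<Rightarrow> ('a set \<times> 'a set set) set set"
  where "indep_filter_base J \<S> =
    (\<lambda>(\<Xi>, E). indep_basic J \<Xi> E) ` (Fpow \<S> \<times> Fpow (indep_index J))"

lemma indep_filter_baseI:
  "\<Xi> \<in> Fpow \<S> \<Longrightarrow> E \<in> Fpow (indep_index J) \<Longrightarrow> indep_basic J \<Xi> E \<in> indep_filter_base J \<S>"
  unfolding indep_filter_base_def by (rule image_eqI[of _ _ "(\<Xi>, E)"]) auto

lemma indep_filter_baseE:
  assumes "A \<in> indep_filter_base J \<S>"
  obtains \<Xi> E where "\<Xi> \<in> Fpow \<S>" "E \<in> Fpow (indep_index J)" "A = indep_basic J \<Xi> E"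
  using assms unfolding indep_filter_base_def by auto

text \<open>Suppose \<open>Y \<notin> \<Xi>\<close>, and let \<open>a\<close> be finite and contain,
  for each \<open>X\<close> in \<open>\<Xi>\<close>, a point telling \<open>X\<close> from
  \<open>Y\<close>. The pair of \<open>a\<close> and the traces of \<open>\<Xi>\<close> on
  \<open>a\<close> lies in every \<open>indep X\<close> but not in \<open>indep Y\<close>.\<close>

lemma indep_independent:
  assumes J: "infinite J" and \<Xi>: "finite \<Xi>" "\<Xi> \<subseteq> Pow J" and Y: "Y \<subseteq> J" and E: "finite E"
    and sub: "indep_basic J \<Xi> E \<subseteq> indep Y"
  shows "Y \<in> \<Xi>"
proof (rule ccontr)
  assume nY: "Y \<notin> \<Xi>"
  have "\<exists>t\<in>J. \<not> (t \<in> X \<longleftrightarrow> t \<in> Y)" if X: "X \<in> \<Xi>" for X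
  proof (rule ccontr)
    assume "\<not> ?thesis"
    moreover have "X \<subseteq> J" using X \<Xi>(2) by blast
    ultimately have "X = Y" using Y by (intro set_eqI) auto
    then show False using X nY by simp
  qed
  then obtain t where t: "\<And>X. X \<in> \<Xi> \<Longrightarrow> t X \<in> J \<and> \<not> (t X \<in> X \<longleftrightarrow> t X \<in> Y)" by metis
  \<comment> \<open>The extra element \<open>j\<close> yields infinitely many such pairs, one of
    which escapes the finite set \<open>E\<close>.\<close>
  define a where "a j = insert j (t ` \<Xi>)" for j
  define p where "p j = (a j, (\<lambda>X. X \<inter> a j) ` \<Xi>)" for j
  have fin: "finite (a j)" for j using \<Xi>(1) unfolding a_def by simp
  have aJ: "a j \<subseteq> J" if "j \<in> J" for j using that t unfolding a_def by auto
  have "infinite (p ` J)"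
  proof
    assume "finite (p ` J)"
    then have "finite (fst ` p ` J)" by (rule finite_imageI)
    then have "finite (a ` J)" unfolding image_image p_def by simp
    then have "finite (\<Union>(a ` J))" using fin by blast
    moreover have "J \<subseteq> \<Union>(a ` J)" unfolding a_def by blast
    ultimately show False using J finite_subset by blast
  qed
  then have "\<not> p ` J \<subseteq> E" using E finite_subset by blast
  then obtain j where j: "j \<in> J" "p j \<notin> E" by blast
  have "p j \<in> indep_index J"
    using aJ[OF j(1)] fin \<Xi>(1) unfolding p_def indep_index_def Fpow_def by auto
  moreover have "\<forall>X\<in>\<Xi>. p j \<in> indep X" unfolding p_def indep_def by auto
  ultimately have "p j \<in> indep Y" using sub j(2) unfolding indep_basic_def by blast
  then obtain X where X: "X \<in> \<Xi>" "Y \<inter> a j = X \<inter> a j" unfolding p_def indep_def by auto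
  moreover have "t X \<in> a j" using X(1) unfolding a_def by blast
  ultimately show False using t[OF X(1)] by blast
qed

lemma empty_Fpow: "{} \<in> Fpow A"
  by (simp add: Fpow_def)

lemma indep_filter_base_hedgehog: "hedgehog (indep_index J) (indep_filter_base J \<S>)"
proof
  show "indep_filter_base J \<S> \<noteq> {}"
    using indep_filter_baseI[OF empty_Fpow empty_Fpow] by blast
  show "\<exists>B\<in>indep_filter_base J \<S>. B \<subseteq> A \<inter> A'"
    if A: "A \<in> indep_filter_base J \<S>" "A' \<in> indep_filter_base J \<S>" for A A'
  proof -
    obtain \<Xi> E where e: "\<Xi> \<in> Fpow \<S>" "E \<in> Fpow (indep_index J)" "A = indep_basic J \<Xi> E"
      using A(1) by (rule indep_filter_baseE)
    obtain \<Xi>' E' where e': "\<Xi>' \<in> Fpow \<S>" "E' \<in> Fpow (indep_index J)" "A' = indep_basic J \<Xi>' E'"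
      using A(2) by (rule indep_filter_baseE)
    have "indep_basic J (\<Xi> \<union> \<Xi>') (E \<union> E') \<in> indep_filter_base J \<S>"
      using e e' by (intro indep_filter_baseI) (auto simp: Fpow_def)
    moreover have "indep_basic J (\<Xi> \<union> \<Xi>') (E \<union> E') \<subseteq> A \<inter> A'"
      unfolding e e' indep_basic_def by auto
    ultimately show ?thesis by (rule rev_bexI)
  qed
  show "\<exists>A\<in>indep_filter_base J \<S>. i \<notin> A" if i: "i \<in> indep_index J" for i
  proof (rule bexI)
    show "indep_basic J {} {i} \<in> indep_filter_base J \<S>"
      using i by (intro indep_filter_baseI) (auto simp: Fpow_def)
    show "i \<notin> indep_basic J {} {i}" by (simp add: indep_basic_def)
  qed
qed

lemma card_indep_index:
  assumes J: "infinite J"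
  shows "|indep_index J| =o |J|"
proof -
  have F: "|Fpow J| \<le>o |J|" using card_of_Fpow_le[OF J] .
  have inj: "inj_on (\<lambda>j. {j}) J" by auto
  have F': "|J| \<le>o |Fpow J|" by (rule card_of_ordLeqI[OF inj]) (auto simp: Fpow_def)
  then have "infinite (Fpow J)" using J card_of_ordLeq_infinite by blast
  then have FF: "|Fpow (Fpow J)| \<le>o |J|" using card_of_Fpow_le F ordLeq_transitive by blast
  have "|indep_index J| \<le>o |J|"
    unfolding indep_index_def using card_of_Times_le_infinite[OF J F FF] .
  moreover have "|J| \<le>o |indep_index J|"
    by (rule card_of_ordLeqI[of "\<lambda>j. ({j}, {})"]) (auto simp: inj_on_def indep_index_def Fpow_def)
  ultimately show ?thesis by (simp add: ordIso_iff_ordLeq)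
qed

text \<open>The shift by \<open>2\<close> is due to spoke points starting at \<open>2\<close>.\<close>

definition leaf_count :: "('i \<Rightarrow> nat set) \<Rightarrow> 'i \<Rightarrow> nat \<Rightarrow> nat"
  where "leaf_count S i x = (if x - 2 \<in> S i then x else 0)"

text \<open>A spoke point with coordinate \<open>x\<close> carries \<open>x\<close> leaves or none,
  so the nonzero leaf counts of arm \<open>i\<close> are the elements of \<open>S i\<close> shifted
  by 2, and \<open>S i\<close> can be read off.\<close>

lemma indep_rigid_hedgehog:
  assumes J: "infinite J" and S: "inj_on S (indep_index J)"
  shows "rigid_hedgehog (indep_index J) (leaf_count S) (indep_filter_base J \<S>)"
proof -
  interpret hedgehog "indep_index J" "leaf_count S" "indep_filter_base J \<S>"
    by (rule indep_filter_base_hedgehog)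
  show ?thesis
  proof
    show "infinite (indep_index J)" using J card_indep_index[OF J] card_of_ordIso_finite by blast
    have "k \<in> S i \<longleftrightarrow> k + 2 \<in> insert 0 (leaf_count S i ` {2..})" for i k
      unfolding leaf_count_def by (auto simp: image_iff split: if_splits intro!: bexI[of _ "k + 2"])
    then show "inj_on (\<lambda>i. insert 0 (leaf_count S i ` {2..})) (indep_index J)"
      using S by (intro inj_onI) (metis inj_onD subset_antisym subsetI)
  qed
qed

section \<open>Spaces from subfamilies of the independent family\<close>

definition indep_space :: "'a set \<Rightarrow> ('a set \<times> 'a set set \<Rightarrow> nat set) \<Rightarrow> 'a set set \<Rightarrow> ('a set \<times> 'a set set) pt topology"
  where "indep_space J S \<S> = hedgehog.X (indep_index J) (leaf_count S) (indep_filter_base J \<S>)"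

text \<open>The basic set given by \<open>Y\<close> alone must contain a basic set for
  \<open>\<T>\<close>; by independence \<open>Y\<close> is among the finitely many members of
  \<open>\<T>\<close> defining the latter.\<close>

lemma indep_space_homeomorphic_imp_subset:
  assumes J: "infinite J" and S: "inj_on S (indep_index J)" and sub: "\<S> \<subseteq> Pow J" "\<T> \<subseteq> Pow J"
    and homeo: "indep_space J S \<S> homeomorphic_space indep_space J S \<T>"
  shows "\<S> \<subseteq> \<T>"
proof
  fix Y assume Y: "Y \<in> \<S>"
  obtain f where f: "homeomorphic_map (indep_space J S \<S>) (indep_space J S \<T>) f"
    using homeo homeomorphic_space by blast
  have "indep_basic J {Y} {} \<in> indep_filter_base J \<S>"
    using Y by (intro indep_filter_baseI) (auto simp: Fpow_def)
  then obtain B where B: "B \<in> indep_filter_base J \<T>" "indep_index J \<inter> B \<subseteq> indep_basic J {Y} {}"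
    using homeomorphic_map_refines[OF indep_rigid_hedgehog[OF J S] indep_rigid_hedgehog[OF J S]
        f[unfolded indep_space_def]] by blast
  obtain \<Xi> E where e: "\<Xi> \<in> Fpow \<T>" "E \<in> Fpow (indep_index J)" "B = indep_basic J \<Xi> E"
    using B(1) by (rule indep_filter_baseE)
  have "Y \<in> \<Xi>"
  proof (rule indep_independent[OF J])
    show "indep_basic J \<Xi> E \<subseteq> indep Y" using B(2) unfolding e indep_basic_def by auto
  qed (use e sub Y in \<open>auto simp: Fpow_def\<close>)
  then show "Y \<in> \<T>" using e by (auto simp: Fpow_def)
qed

lemma indep_space_homeomorphic_iff:
  assumes "infinite J" "inj_on S (indep_index J)" "\<S> \<subseteq> Pow J" "\<T> \<subseteq> Pow J"
  shows "indep_space J S \<S> homeomorphic_space indep_space J S \<T> \<longleftrightarrow> \<S> = \<T>"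
  using indep_space_homeomorphic_imp_subset[OF assms] indep_space_homeomorphic_imp_subset[OF assms(1,2,4,3)]
    homeomorphic_space_sym homeomorphic_space_refl by blast

lemma indep_space_properties:
  assumes J: "infinite J" and S: "inj_on S (indep_index J)"
  shows "clc_Hausdorff (indep_space J S \<S>)" "|topspace (indep_space J S \<S>)| =o |J|"
proof -
  interpret rigid_hedgehog "indep_index J" "leaf_count S" "indep_filter_base J \<S>"
    using indep_rigid_hedgehog[OF J S] .
  show "clc_Hausdorff (indep_space J S \<S>)" using clc_Hausdorff_X unfolding indep_space_def .
  show "|topspace (indep_space J S \<S>)| =o |J|"
    using ordIso_transitive[OF card_points card_indep_index[OF J]] unfolding indep_space_def by simp
qed

text \<open>The upper bound counts neighbourhoods. For the lower bound, each base set yields a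
  filter set involving finitely many members of \<open>\<S>\<close>; by cofinality and independence
  these exhaust \<open>\<S>\<close>, so the base is infinite and at least as large.\<close>

lemma weight_indep_space:
  assumes J: "infinite J" and S: "inj_on S (indep_index J)"
    and \<S>: "\<S> \<subseteq> Pow J" "infinite \<S>" "|J| \<le>o |\<S>|"
  shows "weight (indep_space J S \<S>) =o |\<S>|"
proof -
  interpret rigid_hedgehog "indep_index J" "leaf_count S" "indep_filter_base J \<S>"
    using indep_rigid_hedgehog[OF J S] .
  have I: "|indep_index J| \<le>o |\<S>|"
    using card_indep_index[OF J] \<S>(3) ordIso_ordLeq_trans by blast
  have "|Fpow (indep_index J)| \<le>o |\<S>|"
    using card_of_Fpow_le[OF infinite_I] I ordLeq_transitive by blast
  then have "|Fpow \<S> \<times> Fpow (indep_index J)| \<le>o |\<S>|"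
    using card_of_Times_le_infinite[OF \<S>(2) card_of_Fpow_le[OF \<S>(2)]] by blast
  then have "|indep_filter_base J \<S>| \<le>o |\<S>|"
    unfolding indep_filter_base_def using card_of_image ordLeq_transitive by blast
  then have upper: "weight X \<le>o |\<S>|" using weight_le_card[OF \<S>(2) I] by blast
  obtain \<B> where B: "is_base X \<B>" "weight X = |\<B>|" using weight_attained by blast
  obtain g where g: "\<And>U. g U \<in> indep_filter_base J \<S>"
    "\<And>A. A \<in> indep_filter_base J \<S> \<Longrightarrow> \<exists>U\<in>\<B>. indep_index J \<inter> g U \<subseteq> A"
    using base_cofinal[OF B(1)] by blast
  have "\<exists>\<Xi> E. \<Xi> \<in> Fpow \<S> \<and> E \<in> Fpow (indep_index J) \<and> g U = indep_basic J \<Xi> E" for U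
    using g(1)[of U] by (auto elim!: indep_filter_baseE)
  then obtain \<Xi> E where e: "\<And>U. \<Xi> U \<in> Fpow \<S>" "\<And>U. E U \<in> Fpow (indep_index J)"
    "\<And>U. g U = indep_basic J (\<Xi> U) (E U)" by metis
  have "\<S> \<subseteq> (\<Union>U\<in>\<B>. \<Xi> U)"
  proof
    fix Y assume Y: "Y \<in> \<S>"
    have "indep_basic J {Y} {} \<in> indep_filter_base J \<S>"
      using Y by (intro indep_filter_baseI) (auto simp: Fpow_def)
    then obtain U where U: "U \<in> \<B>" "indep_index J \<inter> g U \<subseteq> indep_basic J {Y} {}" using g(2) by blast
    have "Y \<in> \<Xi> U"
    proof (rule indep_independent[OF J])
      show "indep_basic J (\<Xi> U) (E U) \<subseteq> indep Y" using U(2) unfolding e(3) indep_basic_def by auto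
    qed (use e(1)[of U] e(2)[of U] \<S> Y in \<open>auto simp: Fpow_def\<close>)
    then show "Y \<in> (\<Union>U\<in>\<B>. \<Xi> U)" using U by blast
  qed
  then have le: "|\<S>| \<le>o |\<Union>U\<in>\<B>. \<Xi> U|" by (rule card_of_mono1)
  have fin: "finite (\<Xi> U)" for U using e(1)[of U] by (auto simp: Fpow_def)
  have inf: "infinite \<B>"
  proof
    assume "finite \<B>"
    then have "finite (\<Union>U\<in>\<B>. \<Xi> U)" using fin by blast
    then show False using le \<S>(2) card_of_ordLeq_finite by blast
  qed
  have "|\<Union>U\<in>\<B>. \<Xi> U| \<le>o |\<B>|"
    by (rule card_of_UNION_ordLeq_infinite[OF inf card_of_mono1[OF order_refl]])
      (use card_of_finite_le_infinite[OF fin inf] in blast)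
  then have "|\<S>| \<le>o weight X" using le ordLeq_transitive B(2) by metis
  then show ?thesis using upper unfolding indep_space_def by (simp add: ordIso_iff_ordLeq)
qed

subsection \<open>Counting homeomorphism classes\<close>

lemma weight_le_homeomorphic:
  assumes "X homeomorphic_space Y"
  shows "weight X \<le>o weight Y"
proof -
  obtain g where g: "homeomorphic_map Y X g"
    using assms homeomorphic_space homeomorphic_space_sym by blast
  obtain \<B> where B: "is_base Y \<B>" "weight Y = |\<B>|" using weight_attained by blast
  have inj: "inj_on g (topspace Y)" and im: "g ` topspace Y = topspace X"
    using g by (simp_all add: homeomorphic_imp_injective_map homeomorphic_imp_surjective_map)
  have "is_base X (image g ` \<B>)"
    unfolding is_base_iff
  proof (intro conjI ballI allI impI)
    fix V assume "V \<in> image g ` \<B>"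
    then obtain W where W: "W \<in> \<B>" "V = g ` W" by blast
    then have "openin Y W" using B(1) unfolding is_base_iff by blast
    then show "openin X V"
      using homeomorphic_map_openness[OF g openin_subset] W(2) by blast
  next
    fix U x assume U: "openin X U \<and> x \<in> U"
    define U' where "U' = {y \<in> topspace Y. g y \<in> U}"
    have "openin Y U'"
      using U openin_continuous_map_preimage[OF homeomorphic_imp_continuous_map[OF g]]
      unfolding U'_def by blast
    moreover have "x \<in> g ` topspace Y" using U openin_subset[of X U] im by auto
    then obtain y where y: "y \<in> U'" "g y = x" using U unfolding U'_def by auto
    ultimately obtain V where "V \<in> \<B>" "y \<in> V" "V \<subseteq> U'"
      using B(1) unfolding is_base_iff by meson
    then show "\<exists>V\<in>image g ` \<B>. x \<in> V \<and> V \<subseteq> U" using y(2) unfolding U'_def by blast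
  qed
  then have "weight X \<le>o |image g ` \<B>|" by (rule weight_le)
  then show ?thesis using card_of_image B(2) ordLeq_transitive by metis
qed

lemma weight_homeomorphic: "X homeomorphic_space Y \<Longrightarrow> weight X =o weight Y"
  by (meson homeomorphic_space_sym ordIso_iff_ordLeq weight_le_homeomorphic)

lemma clc_Hausdorff_homeomorphic: "X homeomorphic_space Y \<Longrightarrow> clc_Hausdorff X \<longleftrightarrow> clc_Hausdorff Y"
  unfolding clc_Hausdorff_def
  using homeomorphic_connected_space homeomorphic_locally_connected_space homeomorphic_Hausdorff_space by metis

text \<open>Pulling back along a bijection moves the constructed spaces, whose points are of type
  \<open>pt\<close>, onto a prescribed carrier.\<close>

lemma ex_homeomorphic_on:
  assumes "|topspace X| =o |J|"
  shows "\<exists>Y. topspace Y = J \<and> X homeomorphic_space Y"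
proof -
  obtain g where g: "bij_betw g J (topspace X)" using assms card_of_ordIso ordIso_symmetric by blast
  define Y where "Y = pullback_topology J g X"
  have im: "g ` J = topspace X" and inj: "inj_on g J" using g by (auto simp: bij_betw_def)
  have Y: "topspace Y = J" unfolding Y_def topspace_pullback_topology using im by blast
  have "homeomorphic_map Y X g"
  proof (rule bijective_open_imp_homeomorphic_map)
    show "continuous_map Y X g"
        unfolding continuous_map Y
    proof (intro conjI allI impI)
      fix U assume "openin X U"
      moreover have "{x \<in> J. g x \<in> U} = g -` U \<inter> J" by blast
      ultimately show "openin Y {x \<in> J. g x \<in> U}" unfolding Y_def openin_pullback_topology by blast
    qed (use im in blast)
    show "open_map Y X g"
      unfolding open_map_def Y_def openin_pullback_topology
    proof (intro allI impI, elim exE conjE)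
      fix U V assume "openin X V" "U = g -` V \<inter> J"
      moreover from this have "V \<subseteq> g ` J" using im openin_subset[of X V] by simp
      ultimately have "g ` U = V" by auto
      then show "openin X (g ` U)" using \<open>openin X V\<close> by simp
    qed
  qed (use Y im inj in auto)
  then show ?thesis using Y homeomorphic_map_imp_homeomorphic_space homeomorphic_space_sym by blast
qed

section \<open>Cardinal powers of two\<close>

lemma card_of_Pow_mono: "|A| \<le>o |B| \<Longrightarrow> |Pow A| \<le>o |Pow B|"
proof -
  assume "|A| \<le>o |B|"
  then obtain f where f: "inj_on f A" "f ` A \<subseteq> B" unfolding card_of_ordLeq[symmetric] by blast
  show "|Pow A| \<le>o |Pow B|"
  proof (rule card_of_ordLeqI[OF inj_on_image_Pow[OF f(1)]])
    fix X assume "X \<in> Pow A"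
    then have "f ` X \<subseteq> f ` A" by (intro image_mono) simp
    then show "f ` X \<in> Pow B" using f(2) by simp
  qed
qed

lemma card_of_Pow_cong: "|A| =o |B| \<Longrightarrow> |Pow A| =o |Pow B|"
  by (meson card_of_Pow_mono ordIso_iff_ordLeq)

lemma ctwo_cexp_eq_Pow: "ctwo ^c r =o |Pow (Field r)|"
proof -
  have "ctwo ^c r = |Func (Field r) (UNIV :: bool set)|" by (simp add: cexp_def ctwo_def Field_card_of)
  then show ?thesis using card_of_Pow_Func ordIso_symmetric by metis
qed

lemma continuum_eq_Pow: "continuum =o |UNIV :: nat set set|"
  using ctwo_cexp_eq_Pow[of natLeq] by (simp add: Field_natLeq)

lemma clc_Hausdorff_family:
  fixes \<kappa> :: "'a rel" and lam :: "'b rel"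
  assumes \<kappa>: "Cinfinite \<kappa>" and lam: "Cinfinite lam" and lt: "\<kappa> <o continuum"
    and le: "\<kappa> \<le>o lam" "lam \<le>o ctwo ^c \<kappa>"
  shows "\<exists>\<F> :: 'a topology set. |\<F>| =o ctwo ^c lam \<and> mutually_nonhomeomorphic \<F> \<and>
    (\<forall>X\<in>\<F>. clc_Hausdorff X \<and> |topspace X| =o \<kappa> \<and> weight X =o lam)"
proof -
  define J where "J = Field \<kappa>"
  define L where "L = Field lam"
  have J: "infinite J" and L: "infinite L" using \<kappa> lam by (auto simp: J_def L_def cinfinite_def)
  have cJ: "|J| =o \<kappa>" and cL: "|L| =o lam" 
    using \<kappa> lam card_of_Field_ordIso unfolding J_def L_def by blast+
  have JL: "|J| \<le>o |L|" using le(1) card_of_mono2 unfolding J_def L_def by blast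
  have "|L| \<le>o |Pow J|"
    using cL le(2) ctwo_cexp_eq_Pow[of \<kappa>] unfolding J_def
    by (meson ordIso_ordLeq_trans ordLeq_ordIso_trans)
  \<comment> \<open>Since \<open>lam\<close> is at most the size of \<open>Pow J\<close>, two copies
    of \<open>L\<close> fit in. The first will lie in every \<open>\<S> T\<close>, fixing its size
    at \<open>lam\<close>; the second encodes \<open>T\<close>.\<close>
  then have "|L <+> L| \<le>o |Pow J|"
    using card_of_Plus_infinite1[OF L card_of_mono1[OF order_refl]] ordIso_ordLeq_trans by blast
  then obtain h where h: "inj_on h (L <+> L)" "h ` (L <+> L) \<subseteq> Pow J"
    unfolding card_of_ordLeq[symmetric] by blast
  \<comment> \<open>Here \<open>\<kappa> <o continuum\<close> enters: there are enough sets of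
    naturals to give distinct arms distinct sets.\<close>
  have "|indep_index J| \<le>o |UNIV :: nat set set|"
    using card_indep_index[OF J] cJ lt continuum_eq_Pow
    by (meson ordIso_ordLeq_trans ordLeq_ordIso_trans ordLess_imp_ordLeq)
  then obtain S :: "'a set \<times> 'a set set \<Rightarrow> nat set" where S: "inj_on S (indep_index J)"
    unfolding card_of_ordLeq[symmetric] by blast
  define \<S> where "\<S> T = h ` (L <+> T)" for T :: "'b set"
  have sub: "\<S> T \<subseteq> Pow J" if "T \<subseteq> L" for T
    using h(2) that unfolding \<S>_def by blast
  have card_S: "|\<S> T| =o |L|" if T: "T \<subseteq> L" for T
  proof -
    have "inj_on h (L <+> T)" by (rule inj_on_subset[OF h(1)]) (use T in blast)
    then have "|\<S> T| =o |L <+> T|"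
      unfolding \<S>_def using inj_on_imp_bij_betw card_of_ordIsoI ordIso_symmetric by blast
    then show ?thesis using card_of_Plus_infinite1[OF L card_of_mono1[OF T]] ordIso_transitive by blast
  qed
  have inf_S: "infinite (\<S> T)" if "T \<subseteq> L" for T
    using card_S[OF that] L card_of_ordIso_finite by blast
  have inj_S: "T = T'" if "T \<subseteq> L" "T' \<subseteq> L" "\<S> T = \<S> T'" for T T'
  proof -
    have "L <+> T \<subseteq> L <+> L" "L <+> T' \<subseteq> L <+> L" using that by blast+
    from inj_on_image_eq_iff[OF h(1) this] have "L <+> T = L <+> T'"
      using that(3) unfolding \<S>_def by simp
    then have "t \<in> T \<longleftrightarrow> t \<in> T'" for t by (metis InrI Inr_inject PlusE sum.distinct(1))
    then show ?thesis by blast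
  qed
  have "\<exists>Y :: 'a topology. topspace Y = J \<and> indep_space J S (\<S> T) homeomorphic_space Y" for T
    using indep_space_properties(2)[OF J S] by (rule ex_homeomorphic_on)
  then obtain Y :: "'b set \<Rightarrow> 'a topology" where
    Y: "\<And>T. topspace (Y T) = J" "\<And>T. indep_space J S (\<S> T) homeomorphic_space Y T" by metis
  have eq: "T = T'" if T: "T \<subseteq> L" "T' \<subseteq> L" and h: "Y T homeomorphic_space Y T'" for T T'
  proof -
    have "indep_space J S (\<S> T) homeomorphic_space indep_space J S (\<S> T')"
      using Y(2)[of T] Y(2)[of T'] h by (meson homeomorphic_space_sym homeomorphic_space_trans)
    then show ?thesis
      using indep_space_homeomorphic_iff[OF J S sub[OF T(1)] sub[OF T(2)]] inj_S[OF T] by simp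
  qed
  have "inj_on Y (Pow L)" using eq homeomorphic_space_refl by (metis PowD inj_onI)
  then have "|Y ` Pow L| =o |Pow L|"
    using inj_on_imp_bij_betw card_of_ordIsoI ordIso_symmetric by blast
  then have "|Y ` Pow L| =o ctwo ^c lam"
    using ctwo_cexp_eq_Pow[of lam] unfolding L_def by (meson ordIso_symmetric ordIso_transitive)
  moreover have "mutually_nonhomeomorphic (Y ` Pow L)"
    unfolding mutually_nonhomeomorphic_def pairwise_def using eq by auto
  moreover have "clc_Hausdorff (Y T) \<and> |topspace (Y T)| =o \<kappa> \<and> weight (Y T) =o lam" if T: "T \<subseteq> L" for T
  proof (intro conjI)
    show "clc_Hausdorff (Y T)"
      using indep_space_properties(1)[OF J S] clc_Hausdorff_homeomorphic[OF Y(2)] by blast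
    show "|topspace (Y T)| =o \<kappa>" using Y(1) cJ by simp
    have "|J| \<le>o |\<S> T|" by (rule ordLeq_ordIso_trans[OF JL ordIso_symmetric[OF card_S[OF T]]])
    then have "weight (indep_space J S (\<S> T)) =o |\<S> T|"
      by (rule weight_indep_space[OF J S sub[OF T] inf_S[OF T]])
    then have "weight (indep_space J S (\<S> T)) =o lam"
      by (rule ordIso_transitive[OF _ ordIso_transitive[OF card_S[OF T] cL]])
    then show "weight (Y T) =o lam"
      by (rule ordIso_transitive[OF ordIso_symmetric[OF weight_homeomorphic[OF Y(2)[of T]]]])
  qed
  ultimately show ?thesis by (intro exI[of _ "Y ` Pow L"]) auto
qed

text \<open>A transversal of the homeomorphism classes is at least as large as \<open>\<F>0\<close>,
  whose members lie in different classes.\<close>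

lemma homeomorphism_classes:
  fixes P :: "'a topology \<Rightarrow> bool"
  assumes F0: "\<F>0 \<subseteq> Collect P" "mutually_nonhomeomorphic \<F>0"
  shows "\<exists>\<F>. \<F> \<subseteq> Collect P \<and> mutually_nonhomeomorphic \<F> \<and> |\<F>0| \<le>o |\<F>| \<and>
    (\<forall>X. P X \<longrightarrow> (\<exists>Y\<in>\<F>. X homeomorphic_space Y))"
proof -
  \<comment> \<open>Homeomorphic \<open>X\<close> give equivalent conditions on \<open>Y\<close>, so
    \<open>SOME\<close> returns one and the same representative for a whole class.\<close>
  define rep where "rep X = (SOME Y. P Y \<and> X homeomorphic_space Y)" for X :: "'a topology"
  have rep: "P (rep X) \<and> X homeomorphic_space rep X" if "P X" for X
    unfolding rep_def using that homeomorphic_space_refl by (metis (mono_tags, lifting) someI_ex)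
  have rep_eq: "rep X = rep X'" if "X homeomorphic_space X'" for X X'
  proof -
    have "X homeomorphic_space Y \<longleftrightarrow> X' homeomorphic_space Y" for Y :: "'a topology"
      using that homeomorphic_space_sym homeomorphic_space_trans by metis
    then show ?thesis unfolding rep_def by simp
  qed
  have rep_homeo: "rep X = rep X'" if "P X" "P X'" "rep X homeomorphic_space rep X'" for X X'
    using that rep rep_eq by (meson homeomorphic_space_sym homeomorphic_space_trans)
  show ?thesis
  proof (intro exI[of _ "rep ` Collect P"] conjI allI impI)
    show "rep ` Collect P \<subseteq> Collect P" using rep by auto
    show "mutually_nonhomeomorphic (rep ` Collect P)"
      unfolding mutually_nonhomeomorphic_def pairwise_def using rep_homeo by auto
    have "inj_on rep \<F>0"
    proof (rule inj_onI)
      fix X X' assume X: "X \<in> \<F>0" "X' \<in> \<F>0" "rep X = rep X'"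
      then have "X homeomorphic_space X'"
        using rep[of X] rep[of X'] F0(1) homeomorphic_space_sym homeomorphic_space_trans
        by (metis mem_Collect_eq subsetD)
      then show "X = X'" using F0(2) X unfolding mutually_nonhomeomorphic_def pairwise_def by blast
    qed
    then show "|\<F>0| \<le>o |rep ` Collect P|"
      by (rule card_of_ordLeqI) (use F0 in blast)
    show "\<exists>Y\<in>rep ` Collect P. X homeomorphic_space Y" if "P X" for X
      using rep[OF that] that by blast
  qed
qed

lemma card_topologies_on_nat: "|\<F> :: nat topology set| \<le>o ctwo ^c continuum"
proof -
  have inj: "inj (\<lambda>X :: nat topology. Collect (openin X))" by (auto intro!: injI simp: topology_eq)
  have "|\<F>| \<le>o |UNIV :: nat set set set|"
    by (rule card_of_ordLeqI[OF inj_on_subset[OF inj]]) simp_all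
  moreover have "|UNIV :: nat set set| =o |Field continuum|"
    using continuum_eq_Pow card_of_cong ordIso_symmetric by (metis Field_card_of)
  then have "|UNIV :: nat set set set| =o |Pow (Field continuum)|"
    using card_of_Pow_cong by (metis Pow_UNIV)
  ultimately show ?thesis
    using ctwo_cexp_eq_Pow[of continuum] by (meson ordIso_symmetric ordLeq_ordIso_trans)
qed

text \<open>Such a topology is determined by a sequence enumerating a base, and a sequence of sets
  of naturals is coded by a single one through pairing.\<close>

lemma card_second_countable_topologies_on_nat:
  fixes \<F> :: "nat topology set"
  assumes "\<And>X. X \<in> \<F> \<Longrightarrow> second_countable X"
  shows "|\<F>| \<le>o continuum"
proof -
  define t where "t e = topology (arbitrary union_of (\<lambda>U. U \<in> range e))" for e :: "nat \<Rightarrow> nat set"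
  have "\<F> \<subseteq> t ` UNIV"
  proof
    fix X assume "X \<in> \<F>"
    from assms[OF this] obtain \<B> where B: "countable \<B>" "\<forall>V\<in>\<B>. openin X V"
      "\<forall>U x. openin X U \<and> x \<in> U \<longrightarrow> (\<exists>V\<in>\<B>. x \<in> V \<and> V \<subseteq> U)"
      unfolding second_countable_def by (elim exE conjE)
    \<comment> \<open>Adding the empty set makes the base nonempty, hence the range of a sequence,
      without changing the topology generated.\<close>
    define e where "e = from_nat_into (insert {} \<B>)"
    have e: "range e = insert {} \<B>"
      unfolding e_def using B(1) by (intro range_from_nat_into) auto
    have "is_base X (range e)"
      unfolding e is_base_iff
    proof (intro conjI ballI allI impI)
      fix V assume "V \<in> insert {} \<B>"
      then show "openin X V" using B(2) by auto
    next
      fix U x assume "openin X U \<and> x \<in> U"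
      then have "\<exists>V\<in>\<B>. x \<in> V \<and> V \<subseteq> U" using B(3) by simp
      then show "\<exists>V\<in>insert {} \<B>. x \<in> V \<and> V \<subseteq> U" by blast
    qed
    then have "topology (openin X) = t e" unfolding is_base_def t_def by (rule arg_cong)
    then have "X = t e" by (simp add: openin_inverse)
    then show "X \<in> t ` UNIV" by blast
  qed
  then have "|\<F>| \<le>o |UNIV :: (nat \<Rightarrow> nat set) set|" by (rule surj_imp_ordLeq)
  moreover have "inj (\<lambda>e :: nat \<Rightarrow> nat set. prod_encode ` {(n, k). k \<in> e n})"
  proof (rule injI)
    fix e e' :: "nat \<Rightarrow> nat set"
    assume "prod_encode ` {(n, k). k \<in> e n} = prod_encode ` {(n, k). k \<in> e' n}"
    then have "{(n, k). k \<in> e n} = {(n, k). k \<in> e' n}"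
      by (simp add: inj_image_eq_iff[OF inj_prod_encode])
    then show "e = e'" by (auto simp: fun_eq_iff set_eq_iff)
  qed
  then have "|UNIV :: (nat \<Rightarrow> nat set) set| \<le>o |UNIV :: nat set set|" by (rule card_of_ordLeqI) simp
  ultimately show ?thesis
    using continuum_eq_Pow by (meson ordIso_symmetric ordLeq_ordIso_trans ordLeq_transitive)
qed

lemma second_countable_iff_weight: "second_countable X \<longleftrightarrow> weight X \<le>o natLeq"
proof
  assume "second_countable X"
  then obtain \<B> where "countable \<B>" "is_base X \<B>"
    unfolding second_countable_def is_base_iff by blast
  then show "weight X \<le>o natLeq"
    using weight_le countable_imp_card_of_le ordLeq_transitive by blast
next
  assume w: "weight X \<le>o natLeq"
  obtain \<B> where B: "is_base X \<B>" "weight X = |\<B>|" using weight_attained by blast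
  then have "|\<B>| \<le>o |UNIV :: nat set|"
    using w card_of_nat by (metis ordIso_symmetric ordLeq_ordIso_trans)
  then have "countable \<B>" unfolding card_of_ordLeq[symmetric] by (auto intro: countableI)
  then show "second_countable X" using B(1) unfolding second_countable_def is_base_iff by blast
qed

lemma second_countable_homeomorphic:
  "X homeomorphic_space Y \<Longrightarrow> second_countable X \<longleftrightarrow> second_countable Y"
  unfolding second_countable_iff_weight
  using weight_homeomorphic by (meson ordIso_ordLeq_trans ordIso_symmetric)

lemma ex_homeomorphic_on_nat:
  assumes "|topspace Y| =o natLeq"
  shows "\<exists>X :: nat topology. Y homeomorphic_space X \<and> |topspace X| =o natLeq"
proof -
  have "|topspace Y| =o |UNIV :: nat set|"
    using assms card_of_nat ordIso_symmetric ordIso_transitive by blast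
  then obtain X :: "nat topology" where "topspace X = UNIV" "Y homeomorphic_space X"
    using ex_homeomorphic_on by blast
  then show ?thesis using card_of_nat by metis
qed

lemma Cinfinite_continuum: "Cinfinite continuum"
  using Cinfinite_cexp[OF ordLeq_refl[OF Card_order_ctwo] natLeq_Cinfinite] .

lemma natLeq_less_continuum: "natLeq <o continuum"
  using ordLess_ctwo_cexp[OF natLeq_Card_order] .

text \<open>For the two countable claims the family is built with \<open>\<kappa> = natLeq\<close>
  and \<open>lam\<close> equal to \<open>continuum\<close> or \<open>natLeq\<close>, then replaced
  by a transversal at least as large. Counting topologies on \<open>nat\<close> bounds it from
  above.\<close>

theorem theorem3:
  shows
    "(\<forall>(\<kappa> :: 'a rel) (lam :: 'b rel).
        Cinfinite \<kappa> \<and> Cinfinite lam \<and> \<kappa> <o continuum \<and> \<kappa> \<le>o lam \<and> lam \<le>o ctwo ^c \<kappa> \<longrightarrow>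
        (\<exists>\<F> :: 'a topology set.
            |\<F>| =o ctwo ^c lam \<and>
            mutually_nonhomeomorphic \<F> \<and>
            (\<forall>X\<in>\<F>. clc_Hausdorff X \<and> |topspace X| =o \<kappa> \<and> weight X =o lam)))
     \<and> (\<exists>\<F> :: nat topology set.
            |\<F>| =o ctwo ^c continuum \<and>
            mutually_nonhomeomorphic \<F> \<and>
            (\<forall>X\<in>\<F>. clc_Hausdorff X \<and> |topspace X| =o natLeq) \<and>
            (\<forall>Y :: 'c topology. clc_Hausdorff Y \<and> |topspace Y| =o natLeq \<longrightarrow>
                (\<exists>X\<in>\<F>. Y homeomorphic_space X)))
     \<and> (\<exists>\<F> :: nat topology set.
            |\<F>| =o continuum \<and>
            mutually_nonhomeomorphic \<F> \<and>
            (\<forall>X\<in>\<F>. clc_Hausdorff X \<and> second_countable X \<and> |topspace X| =o natLeq) \<and>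
            (\<forall>Y :: 'c topology. clc_Hausdorff Y \<and> second_countable Y \<and> |topspace Y| =o natLeq \<longrightarrow>
                (\<exists>X\<in>\<F>. Y homeomorphic_space X)))"
proof (intro conjI)
  let ?P = "\<lambda>X :: nat topology. clc_Hausdorff X \<and> |topspace X| =o natLeq"
  let ?Q = "\<lambda>X :: nat topology. clc_Hausdorff X \<and> second_countable X \<and> |topspace X| =o natLeq"
  show "\<forall>(\<kappa> :: 'a rel) (lam :: 'b rel).
      Cinfinite \<kappa> \<and> Cinfinite lam \<and> \<kappa> <o continuum \<and> \<kappa> \<le>o lam \<and> lam \<le>o ctwo ^c \<kappa> \<longrightarrow>
      (\<exists>\<F> :: 'a topology set. |\<F>| =o ctwo ^c lam \<and> mutually_nonhomeomorphic \<F> \<and>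
        (\<forall>X\<in>\<F>. clc_Hausdorff X \<and> |topspace X| =o \<kappa> \<and> weight X =o lam))"
    by (intro allI impI, elim conjE, rule clc_Hausdorff_family) (rule conjI | assumption)+
  show "\<exists>\<F> :: nat topology set. |\<F>| =o ctwo ^c continuum \<and> mutually_nonhomeomorphic \<F> \<and>
      (\<forall>X\<in>\<F>. ?P X) \<and>
      (\<forall>Y :: 'c topology. clc_Hausdorff Y \<and> |topspace Y| =o natLeq \<longrightarrow> (\<exists>X\<in>\<F>. Y homeomorphic_space X))"
  proof -
    obtain \<F>0 :: "nat topology set" where F0: "|\<F>0| =o ctwo ^c continuum"
      "mutually_nonhomeomorphic \<F>0" "\<forall>X\<in>\<F>0. ?P X"
      using clc_Hausdorff_family[OF natLeq_Cinfinite Cinfinite_continuum natLeq_less_continuum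
          ordLess_imp_ordLeq[OF natLeq_less_continuum] ordLeq_refl[OF Card_order_cexp]] by blast
    have "\<F>0 \<subseteq> Collect ?P" using F0(3) by blast
    from homeomorphism_classes[OF this F0(2)] obtain \<F> where F: "\<F> \<subseteq> Collect ?P" "mutually_nonhomeomorphic \<F>" "|\<F>0| \<le>o |\<F>|"
      "\<forall>X. ?P X \<longrightarrow> (\<exists>Y\<in>\<F>. X homeomorphic_space Y)"
      by (elim exE conjE)
    have "ctwo ^c continuum \<le>o |\<F>|" using F0(1) F(3) ordIso_symmetric ordIso_ordLeq_trans by blast
    then have "|\<F>| =o ctwo ^c continuum" using card_topologies_on_nat by (simp add: ordIso_iff_ordLeq)
    moreover have "\<exists>X\<in>\<F>. Y homeomorphic_space X"
      if Y: "clc_Hausdorff Y" "|topspace Y| =o natLeq" for Y :: "'c topology"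
    proof -
      \<comment> \<open>A space of arbitrary type is first copied to one on \<open>nat\<close>, to
        which the transversal applies.\<close>
      obtain X :: "nat topology" where X: "Y homeomorphic_space X" "|topspace X| =o natLeq"
        using ex_homeomorphic_on_nat[OF Y(2)] by blast
      then have "?P X" using Y clc_Hausdorff_homeomorphic by blast
      then show ?thesis using F(4) X(1) homeomorphic_space_trans by meson
    qed
    ultimately show ?thesis using F(1,2) by blast
  qed
  show "\<exists>\<F> :: nat topology set. |\<F>| =o continuum \<and> mutually_nonhomeomorphic \<F> \<and>
      (\<forall>X\<in>\<F>. ?Q X) \<and>
      (\<forall>Y :: 'c topology. clc_Hausdorff Y \<and> second_countable Y \<and> |topspace Y| =o natLeq \<longrightarrow>
        (\<exists>X\<in>\<F>. Y homeomorphic_space X))"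
  proof -
    obtain \<F>0 :: "nat topology set" where F0: "|\<F>0| =o continuum" "mutually_nonhomeomorphic \<F>0"
      "\<forall>X\<in>\<F>0. clc_Hausdorff X \<and> |topspace X| =o natLeq \<and> weight X =o natLeq"
      using clc_Hausdorff_family[OF natLeq_Cinfinite natLeq_Cinfinite natLeq_less_continuum
          ordLeq_refl[OF natLeq_Card_order] ordLess_imp_ordLeq[OF natLeq_less_continuum]] by blast
    have "\<F>0 \<subseteq> Collect ?Q"
      using F0(3) unfolding second_countable_iff_weight by (auto simp: ordIso_iff_ordLeq)
    from homeomorphism_classes[OF this F0(2)] obtain \<F> where F: "\<F> \<subseteq> Collect ?Q" "mutually_nonhomeomorphic \<F>" "|\<F>0| \<le>o |\<F>|"
      "\<forall>X. ?Q X \<longrightarrow> (\<exists>Y\<in>\<F>. X homeomorphic_space Y)"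
      by (elim exE conjE)
    have "continuum \<le>o |\<F>|" using F0(1) F(3) ordIso_symmetric ordIso_ordLeq_trans by blast
    moreover have "|\<F>| \<le>o continuum"
      by (rule card_second_countable_topologies_on_nat) (use F(1) in blast)
    ultimately have "|\<F>| =o continuum" by (simp add: ordIso_iff_ordLeq)
    moreover have "\<exists>X\<in>\<F>. Y homeomorphic_space X"
      if Y: "clc_Hausdorff Y" "second_countable Y" "|topspace Y| =o natLeq" for Y :: "'c topology"
    proof -
      obtain X :: "nat topology" where X: "Y homeomorphic_space X" "|topspace X| =o natLeq"
        using ex_homeomorphic_on_nat[OF Y(3)] by blast
      then have "?Q X" using Y clc_Hausdorff_homeomorphic second_countable_homeomorphic by blast
      then show ?thesis using F(4) X(1) homeomorphic_space_trans by meson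
    qed
    ultimately show ?thesis using F(1,2) by blast
  qed
qed

end
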